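(* Let $F:\mathcal H\to\mathcal H$ be such that for every constant $c>0$ there is $L(c)>0$ with $\|F(U_1)-F(U_2)\|_{\mathcal H}\le L(c)\|U_1-U_2\|_{\mathcal H}$ whenever $\|U_1\|_{\mathcal H}\le c$ and $\|U_2\|_{\mathcal H}\le c$, and such that there is an increasing continuous function $\chi:[0,+\infty)\to[0,+\infty)$ with $\chi(0)=0$ and $\|F(U)\|_{\mathcal H}\le\chi(\|U\|_{\mathcal H})\|U\|_{\mathcal H}$ for all $U\in\mathcal H$. Consider the problem $$(P)\qquad U_t(t)=\mathcal A U(t)+F(U(t))+k\mathcal B U(t-\tau)\ \text{ in }(0,+\infty),\qquad U(0)=U_0,\qquad \mathcal B U(t-\tau)=f(t)\ \ \forall t\in(0,\tau).$$ Suppose that for all $|k|$ sufficiently small the following holds: there exist $\rho_0>0$ and $C_{\rho_0}>0$ such that for all $U_0\in\mathcal H$ and $f\in C([0,\tau];\mathcal H)$ with $$(\ast)\qquad \Big(\|U_0\|_{\mathcal H}^2+\int_0^\tau|k|\,\|f(s)\|_{\mathcal H}^2\,ds\Big)^{1/2}<\rho_0,$$ there exists a unique global (mild) solution $U\in C([0,+\infty),\mathcal H)$ of $(P)$, and it satisfies $$\|U(t)\|_{\mathcal H}\le C_{\rho_0}<\chi^{-1}\Big(\frac{\omega'}{\tilde M}\Big),\qquad\forall t>0,$$ where $\omega'=\omega'(k)$ and $\tilde M=\tilde M(k)$ are the constants given in the context. Then there exists $\tilde k>0$ such that, if $|k|<\tilde k$, there are constants $M^*>0$ and $\tilde\omega>0$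 such that for every $U_0\in\mathcal H$ and $f\in C([0,\tau];\mathcal H)$ satisfying $(\ast)$, the solution $U$ of $(P)$ satisfies $$\|U(t)\|_{\mathcal H}\le M^*e^{-\tilde\omega t}\Big(\|U_0\|_{\mathcal H}+\int_0^\tau e^{\omega s}\|f(s)\|_{\mathcal H}\,ds\Big),\qquad\forall t\ge\tau .$$
   Context: $\mathcal H$ is a Hilbert space with norm $\|\cdot\|_{\mathcal H}$. The operator $\mathcal A$ on $\mathcal H$ generates a $C_0$-semigroup $(S(t))_{t\ge0}$ that is exponentially stable; $M,\omega>0$ are fixed constants with $\|S(t)\|_{\mathcal L(\mathcal H)}\le Me^{-\omega t}$ for all $t\ge0$. The delay $\tau>0$ is fixed, $\mathcal B\in\mathcal L(\mathcal H)$, and $k\in\mathbb R$. A mild solution of $(P)$ is $U\in C([0,+\infty),\mathcal H)$ with $U(t)=S(t)U_0+\int_0^tS(t-s)[F(U(s))+k\mathcal B U(s-\tau)]\,ds$ for $t\ge0$, where $\mathcal B U(s-\tau)$ stands for $f(s)$ when $s\in(0,\tau)$. Constants $\omega'$ and $\tilde M$. Let $k_0:=\dfrac{e^{\tau\omega}-1}{\tau\|\mathcal B\|_{\mathcal L(\mathcal H)}Me^{\tau\omega}}$ ($k_0=+\infty$ if $\mathcal B=0$). For $|k|<k_0$ put $$\omega':=\omega-\tau^{-1}\ln\big(1+|k|\tau\|\mathcal B\|_{\mathcal L(\mathcal H)}Me^{\omega\tau}\big)>0 .$$ With $Z(t,\rho):=\mathcal B U(t-\tau\rho)$, $\rho\in(0,1)$,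 the linear problem ($F=0$) is rewritten as the system $U_t=\mathcal A U+kZ(t,1)$, $Z_t=-\tau^{-1}Z_\rho$, $Z(t,0)=\mathcal B U(t)$, $U(0)=U_0$, $Z(0,\rho)=f((1-\rho)\tau)$, which is governed by a $C_0$-semigroup $(T(t))_{t\ge0}$ on $\tilde{\mathcal H}:=\mathcal H\times L^2(0,1;\mathcal H)$, with generator $(U,Z)\mapsto(\mathcal A U+kZ(1),-\tau^{-1}Z_\rho)$ on the domain $\{(U,Z):U\in D(\mathcal A),\ Z\in H^1(0,1;\mathcal H),\ Z(0)=\mathcal B U\}$. This semigroup is exponentially stable, and $\tilde M>0$ is a fixed constant (depending on $M,\omega,\tau,|k|,\|\mathcal B\|_{\mathcal L(\mathcal H)}$) with $$\|T(t)\|_{\mathcal L(\tilde{\mathcal H})}\le\tilde Me^{-\omega' t},\qquad t>0 .$$ "Increasing" means strictly increasing; $\chi^{-1}$ is the inverse function of $\chi$, with $\chi^{-1}(y)=+\infty$ if $y$ exceeds all values of $\chi$. The numbers $\rho_0,C_{\rho_0}$ may depend on $k$; the hypothesis "for $|k|$ sufficiently small" means for all $k$ with $|k|<\bar k$, for some $\bar k\in(0,k_0]$. *)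

theory Defs
  imports "HOL-Analysis.Analysis"
begin

text \<open>
  The values lie in an arbitrary, possibly non-separable, inner product space, which is why the
  Bochner theory of the library (restricted to second countable spaces) is not used.  The product
  type \<open>'a \<times> 'a L2\<close> carries the norm \<open>sqrt ((norm u)\<^sup>2 + (norm Z)\<^sup>2)\<close>, so it is the Hilbert
  space \<open>H \<times> L\<^sup>2(0,1;H)\<close>.
\<close>

abbreviation unit_leb :: "real measure" where
  "unit_leb \<equiv> lebesgue_on {0<..<1}"

definition strongly_measurable :: "'b measure \<Rightarrow> ('b \<Rightarrow> 'a::real_normed_vector) \<Rightarrow> bool" where
  "strongly_measurable N f \<longleftrightarrow>
     (\<exists>s. (\<forall>i::nat. simple_function N (s i)) \<and> (AE x in N. (\<lambda>i. s i x) \<longlonglongrightarrow> f x))"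

definition square_integrable :: "(real \<Rightarrow> 'a::real_inner) \<Rightarrow> bool" where
  "square_integrable f \<longleftrightarrow>
     strongly_measurable unit_leb f \<and> integrable unit_leb (\<lambda>x. (norm (f x))\<^sup>2)"

definition L2_rel :: "(real \<Rightarrow> 'a::real_inner) \<Rightarrow> (real \<Rightarrow> 'a) \<Rightarrow> bool" where
  "L2_rel f g \<longleftrightarrow>
     square_integrable f \<and> square_integrable g \<and> (AE x in unit_leb. f x = g x)"

lemma strongly_measurable_const: "strongly_measurable N (\<lambda>x. c)"
  unfolding strongly_measurable_def by (rule exI[of _ "\<lambda>i x. c"]) auto

lemma strongly_measurable_compose2:
  assumes f: "strongly_measurable N f" and g: "strongly_measurable N g"
    and h: "continuous_on UNIV (\<lambda>p. h (fst p) (snd p))"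
  shows "strongly_measurable N (\<lambda>x. h (f x) (g x))"
proof -
  obtain s where s: "\<And>i::nat. simple_function N (s i)" "AE x in N. (\<lambda>i. s i x) \<longlonglongrightarrow> f x"
    using f unfolding strongly_measurable_def by blast
  obtain r where r: "\<And>i::nat. simple_function N (r i)" "AE x in N. (\<lambda>i. r i x) \<longlonglongrightarrow> g x"
    using g unfolding strongly_measurable_def by blast
  have 1: "simple_function N (\<lambda>x. h (s i x) (r i x))" for i
    by (rule simple_function_compose2[OF s(1) r(1)])
  have lim: "(\<lambda>i. h (a i) (b i)) \<longlonglongrightarrow> h u v"
    if "a \<longlonglongrightarrow> u" "b \<longlonglongrightarrow> v" for a b u v
  proof -
    have "isCont (\<lambda>p. h (fst p) (snd p)) (u, v)"
      using h by (simp add: continuous_on_eq_continuous_at)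
    moreover have "(\<lambda>i. (a i, b i)) \<longlonglongrightarrow> (u, v)"
      using that by (rule tendsto_Pair)
    ultimately show ?thesis
      using isCont_tendsto_compose[of "(u,v)" "\<lambda>p. h (fst p) (snd p)" "\<lambda>i. (a i, b i)"] by simp
  qed
  have "AE x in N. (\<lambda>i. h (s i x) (r i x)) \<longlonglongrightarrow> h (f x) (g x)"
    using s(2) r(2) by eventually_elim (rule lim)
  with 1 show ?thesis
    unfolding strongly_measurable_def by (intro exI[of _ "\<lambda>i x. h (s i x) (r i x)"]) auto
qed

lemma strongly_measurable_real:
  fixes f :: "real \<Rightarrow> real"
  assumes "strongly_measurable unit_leb f"
  shows "f \<in> borel_measurable unit_leb"
proof -
  obtain s where s: "\<And>i::nat. simple_function unit_leb (s i)"
      "AE x in unit_leb. (\<lambda>i. s i x) \<longlonglongrightarrow> f x"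
    using assms unfolding strongly_measurable_def by blast
  define g where "g x = lim (\<lambda>i. s i x)" for x
  have g: "g \<in> borel_measurable unit_leb"
    unfolding g_def
    by (rule borel_measurable_lim_metric) (rule borel_measurable_simple_function[OF s(1)])
  have "AE x in unit_leb. g x = f x"
    using s(2) by eventually_elim (simp add: g_def limI)
  then have ae: "AE x in lebesgue. (if x \<in> {0<..<1} then g x else 0) = (if x \<in> {0<..<1} then f x else 0)"
    by (subst (asm) AE_restrict_space_iff) (auto elim!: eventually_mono)
  have "(\<lambda>x. if x \<in> {0<..<1} then g x else 0) \<in> borel_measurable lebesgue"
    by (rule borel_measurable_if_I[OF g]) auto
  from borel_measurable_AE[OF this ae]
  show ?thesis by (rule borel_measurable_if_D)
qed

lemma square_integrable_zero: "square_integrable (\<lambda>x. 0)"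
  by (simp add: square_integrable_def strongly_measurable_const)

lemma square_integrable_inner:
  assumes "square_integrable f" "square_integrable g"
  shows "integrable unit_leb (\<lambda>x. f x \<bullet> g x)"
proof (rule Bochner_Integration.integrable_bound)
  show "integrable unit_leb (\<lambda>x. (norm (f x))\<^sup>2 + (norm (g x))\<^sup>2)"
    using assms by (simp add: square_integrable_def)
  have "strongly_measurable unit_leb (\<lambda>x. f x \<bullet> g x)"
    using assms unfolding square_integrable_def
    by (intro strongly_measurable_compose2[where h = inner]) (auto intro!: continuous_intros)
  then show "(\<lambda>x. f x \<bullet> g x) \<in> borel_measurable unit_leb"
    by (rule strongly_measurable_real)
  have "norm (u \<bullet> v) \<le> norm ((norm u)\<^sup>2 + (norm v)\<^sup>2)" for u v :: 'a
  proof -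
    have "\<bar>u \<bullet> v\<bar> \<le> norm u * norm v" by (rule Cauchy_Schwarz_ineq2)
    also have "\<dots> \<le> (norm u)\<^sup>2 + (norm v)\<^sup>2"
      using sum_squares_bound[of "norm u" "norm v"]
        mult_nonneg_nonneg[OF norm_ge_zero[of u] norm_ge_zero[of v]] by linarith
    finally show ?thesis by simp
  qed
  then show "AE x in unit_leb. norm (f x \<bullet> g x) \<le> norm ((norm (f x))\<^sup>2 + (norm (g x))\<^sup>2)"
    by simp
qed

lemma square_integrable_add:
  assumes "square_integrable f" "square_integrable g"
  shows "square_integrable (\<lambda>x. f x + g x)"
proof -
  have "(norm (f x + g x))\<^sup>2 = (norm (f x))\<^sup>2 + 2 * (f x \<bullet> g x) + (norm (g x))\<^sup>2" for x
    by (simp add: power2_norm_eq_inner inner_add_left inner_add_right inner_commute)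
  moreover have "strongly_measurable unit_leb (\<lambda>x. f x + g x)"
    using assms unfolding square_integrable_def
    by (intro strongly_measurable_compose2[where h = plus]) (auto intro!: continuous_intros)
  ultimately show ?thesis
    using assms square_integrable_inner[OF assms] by (simp add: square_integrable_def)
qed

lemma square_integrable_scaleR:
  assumes "square_integrable f"
  shows "square_integrable (\<lambda>x. c *\<^sub>R f x)"
proof -
  have "strongly_measurable unit_leb (\<lambda>x. c *\<^sub>R f x)"
    using assms unfolding square_integrable_def
    by (intro strongly_measurable_compose2[where h = "\<lambda>u v. c *\<^sub>R u" and g = f])
       (auto intro!: continuous_intros)
  then show ?thesis
    using assms by (simp add: square_integrable_def power_mult_distrib)
qed

quotient_type (overloaded) 'a L2 = "real \<Rightarrow> 'a::real_inner" / partial: L2_rel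
proof (rule part_equivpI)
  show "\<exists>f. L2_rel f (f :: real \<Rightarrow> 'a)"
    by (rule exI[of _ "\<lambda>x. 0"]) (simp add: L2_rel_def square_integrable_zero)
  show "symp (L2_rel :: (real \<Rightarrow> 'a) \<Rightarrow> _)"
    by (auto simp: symp_def L2_rel_def)
  show "transp (L2_rel :: (real \<Rightarrow> 'a) \<Rightarrow> _)"
    by (auto simp: transp_def L2_rel_def elim: eventually_elim2)
qed

instantiation L2 :: (real_inner) real_inner
begin

lift_definition zero_L2 :: "'a L2" is "\<lambda>x. 0"
  by (simp add: L2_rel_def square_integrable_zero)

lift_definition plus_L2 :: "'a L2 \<Rightarrow> 'a L2 \<Rightarrow> 'a L2" is "\<lambda>f g x. f x + g x"
  by (auto simp: L2_rel_def intro: square_integrable_add elim: eventually_elim2)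

lift_definition scaleR_L2 :: "real \<Rightarrow> 'a L2 \<Rightarrow> 'a L2" is "\<lambda>c f x. c *\<^sub>R f x"
  by (auto simp: L2_rel_def intro: square_integrable_scaleR elim: eventually_mono)

lift_definition uminus_L2 :: "'a L2 \<Rightarrow> 'a L2" is "\<lambda>f x. - f x"
  using square_integrable_scaleR[where c = "-1"]
  by (auto simp: L2_rel_def elim: eventually_mono)

definition minus_L2 :: "'a L2 \<Rightarrow> 'a L2 \<Rightarrow> 'a L2" where
  "minus_L2 Y Z = Y + - Z"

lift_definition inner_L2 :: "'a L2 \<Rightarrow> 'a L2 \<Rightarrow> real" is
  "\<lambda>f g. integral\<^sup>L unit_leb (\<lambda>x. f x \<bullet> g x)"
proof -
  fix f f' g g' :: "real \<Rightarrow> 'a"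
  assume f: "L2_rel f f'" and g: "L2_rel g g'"
  show "integral\<^sup>L unit_leb (\<lambda>x. f x \<bullet> g x) = integral\<^sup>L unit_leb (\<lambda>x. f' x \<bullet> g' x)"
  proof (rule integral_cong_AE)
    show "(\<lambda>x. f x \<bullet> g x) \<in> borel_measurable unit_leb" "(\<lambda>x. f' x \<bullet> g' x) \<in> borel_measurable unit_leb"
      using f g square_integrable_inner by (auto simp: L2_rel_def intro: borel_measurable_integrable)
    show "AE x in unit_leb. f x \<bullet> g x = f' x \<bullet> g' x"
      using f g by (auto simp: L2_rel_def elim: eventually_elim2)
  qed
qed

definition norm_L2 :: "'a L2 \<Rightarrow> real" where "norm_L2 Z = sqrt (inner Z Z)"
definition dist_L2 :: "'a L2 \<Rightarrow> 'a L2 \<Rightarrow> real" where "dist_L2 Y Z = norm (Y - Z)"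
definition sgn_L2 :: "'a L2 \<Rightarrow> 'a L2" where "sgn_L2 Z = inverse (norm Z) *\<^sub>R Z"
definition uniformity_L2 :: "('a L2 \<times> 'a L2) filter" where
  "uniformity_L2 = (INF e\<in>{0 <..}. principal {(Y, Z). dist Y Z < e})"
definition open_L2 :: "'a L2 set \<Rightarrow> bool" where
  "open_L2 U \<longleftrightarrow> (\<forall>Y\<in>U. eventually (\<lambda>(Y', Z). Y' = Y \<longrightarrow> Z \<in> U) uniformity)"

instance
proof
  fix X Y Z :: "'a L2" and a b :: real
  note si = square_integrable_add square_integrable_scaleR square_integrable_zero
  have sm: "square_integrable (\<lambda>x. - f x)" if "square_integrable f" for f :: "real \<Rightarrow> 'a"
    using square_integrable_scaleR[OF that, of "-1"] by simp
  show "X + Y + Z = X + (Y + Z)"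
    by transfer (auto simp: L2_rel_def add.assoc intro!: si)
  show "X + Y = Y + X"
    by transfer (auto simp: L2_rel_def add.commute intro!: si)
  show "0 + X = X"
    by transfer (auto simp: L2_rel_def)
  show "- X + X = 0"
    by transfer (auto simp: L2_rel_def intro!: si)
  show "X - Y = X + - Y"
    by (simp add: minus_L2_def)
  show "a *\<^sub>R (X + Y) = a *\<^sub>R X + a *\<^sub>R Y"
    by transfer (auto simp: L2_rel_def scaleR_add_right intro!: si)
  show "(a + b) *\<^sub>R X = a *\<^sub>R X + b *\<^sub>R X"
    by transfer (auto simp: L2_rel_def scaleR_add_left intro!: si)
  show "a *\<^sub>R b *\<^sub>R X = (a * b) *\<^sub>R X"
    by transfer (auto simp: L2_rel_def intro!: si)
  show "1 *\<^sub>R X = X"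
    by transfer (auto simp: L2_rel_def)
  show "sgn X = inverse (norm X) *\<^sub>R X"
    by (simp add: sgn_L2_def)
  show "dist X Y = norm (X - Y)"
    by (simp add: dist_L2_def)
  show "uniformity = (INF e\<in>{0 <..}. principal {(Y, Z :: 'a L2). dist Y Z < e})"
    by (simp add: uniformity_L2_def)
  show "open U \<longleftrightarrow> (\<forall>Y\<in>U. eventually (\<lambda>(Y', Z). Y' = Y \<longrightarrow> Z \<in> U) uniformity)"
    for U :: "'a L2 set"
    by (simp add: open_L2_def)
  show "X \<bullet> Y = Y \<bullet> X"
    by transfer (simp add: inner_commute)
  show "(X + Y) \<bullet> Z = X \<bullet> Z + Y \<bullet> Z"
    by transfer (auto simp: L2_rel_def inner_add_left square_integrable_inner)
  show "(a *\<^sub>R X) \<bullet> Y = a * (X \<bullet> Y)"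
    by transfer simp
  show "0 \<le> X \<bullet> X"
    by transfer simp
  show "X \<bullet> X = 0 \<longleftrightarrow> X = 0"
    by transfer
       (auto simp: L2_rel_def square_integrable_zero square_integrable_inner
                   integral_nonneg_eq_0_iff_AE)
  show "norm X = sqrt (X \<bullet> X)"
    by (simp add: norm_L2_def)
qed

end


definition C0_semigroup :: "(real \<Rightarrow> 'b::real_normed_vector \<Rightarrow>\<^sub>L 'b) \<Rightarrow> bool" where
  "C0_semigroup S \<longleftrightarrow>
     S 0 = id_blinfun \<and>
     (\<forall>s\<ge>0. \<forall>t\<ge>0. S (s + t) = S s o\<^sub>L S t) \<and>
     (\<forall>x. ((\<lambda>t. blinfun_apply (S t) x) \<longlongrightarrow> x) (at_right 0))"

text \<open>Unbounded operators are represented by their graphs.\<close>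

definition generator :: "(real \<Rightarrow> 'b::real_normed_vector \<Rightarrow>\<^sub>L 'b) \<Rightarrow> ('b \<times> 'b) set" where
  "generator S =
     {(x, y). ((\<lambda>h. (1 / h) *\<^sub>R (blinfun_apply (S h) x - x)) \<longlongrightarrow> y) (at_right 0)}"

text \<open>
  \<open>H1_deriv Z z Z'\<close>: the class \<open>Z\<close> lies in \<open>H\<^sup>1(0,1;H)\<close>, with absolutely continuous
  representative \<open>z\<close> on \<open>[0,1]\<close> (used for the traces at 0 and 1) and derivative \<open>Z'\<close> in \<open>L\<^sup>2\<close>.
  Bochner integrable functions are Henstock-Kurzweil integrable with the same integral.
\<close>

definition H1_deriv ::
  "'a::{real_inner, complete_space} L2 \<Rightarrow> (real \<Rightarrow> 'a) \<Rightarrow> 'a L2 \<Rightarrow> bool" where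
  "H1_deriv Z z Z' \<longleftrightarrow>
     (AE x in unit_leb. rep_L2 Z x = z x) \<and>
     (\<forall>x\<in>{0..1}. (rep_L2 Z' has_integral (z x - z 0)) {0..x})"

definition delay_operator ::
  "('a \<times> 'a) set \<Rightarrow> ('a \<Rightarrow>\<^sub>L 'a) \<Rightarrow> real \<Rightarrow> real \<Rightarrow>
    (('a \<times> 'a L2) \<times> ('a::{real_inner, complete_space} \<times> 'a L2)) set" where
  "delay_operator A B \<tau> k =
     {((u, Z), (a + k *\<^sub>R z 1, - (1 / \<tau>) *\<^sub>R Z')) | u Z a z Z'.
        (u, a) \<in> A \<and> H1_deriv Z z Z' \<and> z 0 = blinfun_apply B u}"


definition k_zero ::
  "real \<Rightarrow> real \<Rightarrow> ('a::real_normed_vector \<Rightarrow>\<^sub>L 'a) \<Rightarrow> real \<Rightarrow> ereal" where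
  "k_zero M \<omega> B \<tau> =
     (if B = 0 then \<infinity>
      else ereal ((exp (\<tau> * \<omega>) - 1) / (\<tau> * norm B * M * exp (\<tau> * \<omega>))))"

definition omega_prime ::
  "real \<Rightarrow> real \<Rightarrow> ('a::real_normed_vector \<Rightarrow>\<^sub>L 'a) \<Rightarrow> real \<Rightarrow> real \<Rightarrow> real" where
  "omega_prime M \<omega> B \<tau> k =
     \<omega> - (1 / \<tau>) * ln (1 + \<bar>k\<bar> * \<tau> * norm B * M * exp (\<omega> * \<tau>))"

definition extended_inverse :: "(real \<Rightarrow> real) \<Rightarrow> real \<Rightarrow> ereal" where
  "extended_inverse chi y =
     (if \<forall>x\<ge>0. chi x < y then \<infinity> else ereal (the_inv_into {0..} chi y))"


text \<open>
  The integrand below is piecewise continuous (with a possible jump at \<open>\<tau>\<close>) for continuous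
  \<open>F\<close>, \<open>f\<close> and \<open>U\<close>, hence integrable.
\<close>

definition mild_solution ::
  "(real \<Rightarrow> 'a \<Rightarrow>\<^sub>L 'a) \<Rightarrow> ('a \<Rightarrow> 'a) \<Rightarrow> ('a \<Rightarrow>\<^sub>L 'a) \<Rightarrow> real \<Rightarrow> real \<Rightarrow> 'a \<Rightarrow> (real \<Rightarrow> 'a) \<Rightarrow>
    (real \<Rightarrow> 'a::{real_inner, complete_space}) \<Rightarrow> bool" where
  "mild_solution S F B \<tau> k U0 f U \<longleftrightarrow>
     continuous_on {0..} U \<and>
     (\<forall>t\<ge>0. U t = blinfun_apply (S t) U0 +
        integral {0..t} (\<lambda>s. blinfun_apply (S (t - s))
          (F (U s) + k *\<^sub>R (if s < \<tau> then f s else blinfun_apply B (U (s - \<tau>))))))"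

definition small_data :: "real \<Rightarrow> real \<Rightarrow> real \<Rightarrow> 'a::real_inner \<Rightarrow> (real \<Rightarrow> 'a) \<Rightarrow> bool" where
  "small_data \<tau> k r U0 f \<longleftrightarrow>
     sqrt ((norm U0)\<^sup>2 + integral {0..\<tau>} (\<lambda>s. \<bar>k\<bar> * (norm (f s))\<^sup>2)) < r"

end

theory Submission
  imports Defs
begin

text \<open>
  Fix a small \<open>k\<close>.  Two facts give the decay.  The delay semigroup \<open>T\<close> decays like
  \<open>Mt * exp (- \<omega>' * t)\<close>, and along the solution the nonlinearity is at most
  \<open>chi (C k) * norm (U t)\<close>, where the bound on \<open>C k\<close> says exactly that
  \<open>Mt * chi (C k) < \<omega>'\<close> (\<open>less_extended_inverse\<close>).  So the nonlinear term is a perturbation that is too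
  weak to destroy the decay of the linear delay system: the variation of constants formula for
  \<open>T\<close>, started at time \<open>\<tau>\<close>, and Gronwall's inequality give the rate
  \<open>\<omega>' - Mt * chi (C k)\<close> (\<open>decay_beyond_delay\<close>).  On \<open>{0..\<tau>}\<close> the delayed term is
  given data, and a second use of Gronwall's inequality, with \<open>S\<close> only, bounds the solution by the
  data (\<open>bound_up_to_delay\<close>).

  The solution is given by the mild formula for \<open>S\<close>, whereas \<open>T\<close> is known only through its generator.
  Instead of computing \<open>T\<close>, the proof regularises the solution.  The average of \<open>U\<close> over
  \<open>{t..t + \<epsilon>}\<close> lies in the domain of the generator of \<open>S\<close> (\<open>average_in_generator\<close>) and is
  continuously differentiable in \<open>t\<close>; therefore the pair of the average and its delayed history lies in the
  domain of the delay operator (\<open>state_in_delay_operator\<close>) and solves the abstract equation with the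
  averaged nonlinearity as a source.  For such strong solutions the variation of constants formula
  holds in the form of a norm inequality (\<open>semigroup_duhamel_bound\<close>), proved by a mean value
  inequality for right derivatives without integrating in \<open>'a \<times> 'a L2\<close>.  Letting \<open>\<epsilon>\<close>
  tend to 0 yields \<open>delay_duhamel_bound\<close>.
\<close>

section \<open>Strongly continuous semigroups and the Duhamel inequality\<close>

lemma C0_semigroup_zero: "C0_semigroup S \<Longrightarrow> blinfun_apply (S 0) x = x"
  by (simp add: C0_semigroup_def id_blinfun.rep_eq)

lemma C0_semigroup_add:
  "C0_semigroup S \<Longrightarrow> s \<ge> 0 \<Longrightarrow> t \<ge> 0 \<Longrightarrow>
     blinfun_apply (S (s + t)) x = blinfun_apply (S s) (blinfun_apply (S t) x)"
  by (simp add: C0_semigroup_def)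

lemma C0_semigroup_continuous_orbit:
  fixes S :: "real \<Rightarrow> 'b::real_normed_vector \<Rightarrow>\<^sub>L 'b"
  assumes S: "C0_semigroup S" and bound: "\<And>t. t \<ge> 0 \<Longrightarrow> norm (S t) \<le> K"
  shows "continuous_on {0..} (\<lambda>t. blinfun_apply (S t) x)"
  unfolding continuous_on_iff
proof (intro ballI allI impI)
  fix t e :: real
  assume t: "t \<in> {0..}" and e: "e > 0"
  have K: "K \<ge> 0" using bound[of 0] norm_ge_zero[of "S 0"] by linarith
  have "((\<lambda>t. blinfun_apply (S t) x) \<longlongrightarrow> x) (at_right 0)"
    using S by (simp add: C0_semigroup_def)
  then have "eventually (\<lambda>h. dist (blinfun_apply (S h) x) x < e / (K + 1)) (at_right 0)"
    by (rule tendstoD) (use e K in simp)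
  then obtain d where d: "d > 0" "\<And>h. h > 0 \<Longrightarrow> h < d \<Longrightarrow> dist (blinfun_apply (S h) x) x < e / (K + 1)"
    unfolding eventually_at_right_field by auto
  show "\<exists>d>0. \<forall>t'\<in>{0..}. dist t' t < d \<longrightarrow> dist (blinfun_apply (S t') x) (blinfun_apply (S t) x) < e"
  proof (intro exI[of _ d] conjI ballI impI d(1))
    fix t' assume t': "t' \<in> {0..}" "dist t' t < d"
    define m where "m = min t t'"
    define h where "h = \<bar>t' - t\<bar>"
    have m: "m \<ge> 0" "h \<ge> 0" "h < d" using t t' by (auto simp: m_def h_def dist_real_def)
    have "dist (blinfun_apply (S h) x) x < e / (K + 1)"
    proof (cases "h = 0")
      case True
      then show ?thesis using e K by (simp add: C0_semigroup_zero[OF S])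
    next
      case False
      then show ?thesis using d(2)[of h] m by simp
    qed
    then have hx: "norm (blinfun_apply (S h) x - x) < e / (K + 1)" by (simp add: dist_norm)
    have "dist (blinfun_apply (S t') x) (blinfun_apply (S t) x)
        = dist (blinfun_apply (S (m + h)) x) (blinfun_apply (S m) x)"
      by (cases "t \<le> t'") (auto simp: m_def h_def dist_commute)
    also have "\<dots> = norm (blinfun_apply (S m) (blinfun_apply (S h) x - x))"
      by (simp add: C0_semigroup_add[OF S m(1,2)] dist_norm blinfun.diff_right)
    also have "\<dots> \<le> norm (S m) * norm (blinfun_apply (S h) x - x)" by (rule norm_blinfun)
    also have "\<dots> \<le> K * norm (blinfun_apply (S h) x - x)"
      by (intro mult_right_mono bound m) simp
    also have "\<dots> \<le> K * (e / (K + 1))" using hx K by (intro mult_left_mono) auto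
    also have "\<dots> < e" using e K by (simp add: field_simps)
    finally show "dist (blinfun_apply (S t') x) (blinfun_apply (S t) x) < e" .
  qed
qed

text \<open>
  Strong continuity alone gives continuity in \<open>t\<close> for a fixed vector; the uniform bound on the
  operators makes the orbit maps equicontinuous, and this upgrades it to joint continuity.
\<close>

lemma C0_semigroup_continuous_joint:
  fixes S :: "real \<Rightarrow> 'b::real_normed_vector \<Rightarrow>\<^sub>L 'b"
  assumes S: "C0_semigroup S" and bound: "\<And>t. t \<ge> 0 \<Longrightarrow> norm (S t) \<le> K"
    and c: "continuous_on X c" "\<And>p. p \<in> X \<Longrightarrow> c p \<ge> 0" and v: "continuous_on X v"
  shows "continuous_on X (\<lambda>p. blinfun_apply (S (c p)) (v p))"
  unfolding continuous_on_def
proof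
  fix p assume p: "p \<in> X"
  have orbit: "((\<lambda>q. blinfun_apply (S (c q)) (v p)) \<longlongrightarrow> blinfun_apply (S (c p)) (v p)) (at p within X)"
    using continuous_on_compose2[OF C0_semigroup_continuous_orbit[OF S bound] c(1), of "v p"] c(2) p
    unfolding continuous_on_def by auto
  have "((\<lambda>q. blinfun_apply (S (c q)) (v q - v p)) \<longlongrightarrow> 0) (at p within X)"
  proof (rule Lim_null_comparison)
    show "\<forall>\<^sub>F q in at p within X. norm (blinfun_apply (S (c q)) (v q - v p)) \<le> K * norm (v q - v p)"
      unfolding eventually_at_filter
      by (intro always_eventually allI impI order.trans[OF norm_blinfun] mult_right_mono bound c(2)) auto
    have "((\<lambda>q. v q) \<longlongrightarrow> v p) (at p within X)" using v p by (simp add: continuous_on_def)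
    then have "((\<lambda>q. K * norm (v q - v p)) \<longlongrightarrow> K * norm (v p - v p)) (at p within X)"
      by (intro tendsto_intros)
    then show "((\<lambda>q. K * norm (v q - v p)) \<longlongrightarrow> 0) (at p within X)" by simp
  qed
  from tendsto_add[OF this orbit]
  show "((\<lambda>p. blinfun_apply (S (c p)) (v p)) \<longlongrightarrow> blinfun_apply (S (c p)) (v p)) (at p within X)"
    by (simp add: blinfun.diff_right)
qed

text \<open>
  A mean value inequality that only looks to the right.  One-sided increments are all that a
  semigroup orbit offers conveniently: the increment to the left would need the operator
  difference quotient to converge uniformly along the curve.  For every slack \<open>e\<close> the set where
  \<open>norm (\<phi> s - \<phi> a)\<close> stays below \<open>\<psi> s - \<psi> a + e * (s - a)\<close> is compact, and the hypothesis pushes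
  its maximum up to \<open>b\<close>.
\<close>

lemma right_derivative_bound:
  fixes \<phi> :: "real \<Rightarrow> 'b::real_normed_vector" and \<psi> g :: "real \<Rightarrow> real"
  assumes ab: "a \<le> b" and \<phi>: "continuous_on {a..b} \<phi>"
    and \<psi>: "\<And>s. s \<in> {a..b} \<Longrightarrow> (\<psi> has_real_derivative g s) (at s within {a..b})"
    and incr: "\<And>s e. s \<in> {a..<b} \<Longrightarrow> e > 0 \<Longrightarrow>
      eventually (\<lambda>h. norm (\<phi> (s + h) - \<phi> s) \<le> h * (g s + e)) (at_right 0)"
  shows "norm (\<phi> b - \<phi> a) \<le> \<psi> b - \<psi> a"
proof (rule field_le_epsilon)
  fix e' :: real assume e': "e' > 0"
  define e where "e = e' / (b - a + 1)"
  have e: "e > 0" using e' ab by (simp add: e_def)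
  define N where "N s = norm (\<phi> s - \<phi> a) - (\<psi> s - \<psi> a) - e * (s - a)" for s
  have \<psi>c: "continuous_on {a..b} \<psi>"
    using \<psi> by (meson DERIV_continuous continuous_on_eq_continuous_within)
  have N: "continuous_on {a..b} N"
    unfolding N_def by (intro continuous_intros \<phi> \<psi>c)
  have "closed ({a..b} \<inter> N -` {..0})"
    by (rule continuous_closed_preimage[OF N]) auto
  then have "compact ({a..b} \<inter> N -` {..0})"
    using compact_Int_closed[OF compact_Icc, of "{a..b} \<inter> N -` {..0}" a b] by simp
  moreover have "a \<in> {a..b} \<inter> N -` {..0}" using ab by (simp add: N_def)
  ultimately obtain c where c: "c \<in> {a..b} \<inter> N -` {..0}" "\<And>s. s \<in> {a..b} \<inter> N -` {..0} \<Longrightarrow> s \<le> c"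
    using compact_attains_sup[of "{a..b} \<inter> N -` {..0}"] by blast
  have "c = b"
  proof (rule ccontr)
    assume "c \<noteq> b"
    then have cb: "c \<in> {a..<b}" using c by auto
    have "(\<psi> has_real_derivative g c) (at c within {c..b})"
      by (rule DERIV_subset[OF \<psi>]) (use cb in auto)
    then have "((\<lambda>s. (\<psi> s - \<psi> c) / (s - c)) \<longlongrightarrow> g c) (at_right c)"
      using cb by (simp add: has_field_derivative_iff at_within_Icc_at_right)
    then have "eventually (\<lambda>s. dist ((\<psi> s - \<psi> c) / (s - c)) (g c) < e / 2) (at_right c)"
      by (rule tendstoD) (use e in simp)
    then have 1: "eventually (\<lambda>h. dist ((\<psi> (c + h) - \<psi> c) / h) (g c) < e / 2) (at_right 0)"
      unfolding eventually_at_right_to_0[of _ c] by (simp add: add.commute)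
    have 2: "eventually (\<lambda>h. norm (\<phi> (c + h) - \<phi> c) \<le> h * (g c + e / 2)) (at_right 0)"
      using incr[OF cb, of "e / 2"] e by simp
    have 3: "eventually (\<lambda>h. 0 < h \<and> h < b - c) (at_right 0)"
      using cb eventually_at_right_real[of 0 "b - c"] by simp
    have "eventually (\<lambda>h::real. False) (at_right 0)"
      using 1 2 3
    proof eventually_elim
      case (elim h)
      have "(\<psi> (c + h) - \<psi> c) / h \<ge> g c - e / 2" using elim(1) unfolding dist_real_def by linarith
      then have "\<psi> (c + h) - \<psi> c \<ge> h * (g c - e / 2)" using elim(3) by (simp add: field_simps)
      moreover have "norm (\<phi> (c + h) - \<phi> a) \<le> norm (\<phi> (c + h) - \<phi> c) + norm (\<phi> c - \<phi> a)"
        using norm_triangle_ineq[of "\<phi> (c + h) - \<phi> c" "\<phi> c - \<phi> a"] by simp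
      ultimately have "N (c + h) \<le> N c"
        using elim(2) unfolding N_def by (simp add: algebra_simps)
      then have "c + h \<le> c" using c cb elim(3) by (intro c(2)) auto
      then show False using elim(3) by simp
    qed
    then show False by simp
  qed
  then have "norm (\<phi> b - \<phi> a) \<le> \<psi> b - \<psi> a + e * (b - a)" using c by (simp add: N_def)
  also have "e * (b - a) \<le> e'" using e' ab by (simp add: e_def field_simps)
  finally show "norm (\<phi> b - \<phi> a) \<le> \<psi> b - \<psi> a + e'" by simp
qed

text \<open>
  The norm form of the variation of constants formula for \<open>W' = G W + q\<close>, where \<open>G\<close> generates \<open>T\<close>.
  The curve \<open>s \<mapsto> T (b - s) (W s)\<close> joins \<open>T (b - a) (W a)\<close> to \<open>W b\<close>, and its right derivative
  is \<open>T (b - s) (q s)\<close>, because the two contributions \<open>G W\<close> cancel.  Only norms are integrated; a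
  vector-valued integral would call for completeness of \<open>'a \<times> 'a L2\<close>.
\<close>

lemma semigroup_duhamel_bound:
  fixes T :: "real \<Rightarrow> 'b::real_normed_vector \<Rightarrow>\<^sub>L 'b"
  assumes T: "C0_semigroup T" and bound: "\<And>t. t > 0 \<Longrightarrow> norm (T t) \<le> K * exp (- w * t)"
    and w: "w \<ge> 0" and ab: "a < b"
    and W: "continuous_on {a..b} W" and p: "continuous_on {a..b} p"
    and gen: "\<And>s. s \<in> {a..<b} \<Longrightarrow> (W s, y s) \<in> generator T"
    and deriv: "\<And>s. s \<in> {a..<b} \<Longrightarrow>
      ((\<lambda>h. (1 / h) *\<^sub>R (W (s + h) - W s)) \<longlongrightarrow> y s + q s) (at_right 0)"
    and q: "\<And>s. s \<in> {a..<b} \<Longrightarrow> norm (q s) \<le> p s"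
  shows "norm (W b) \<le> K * exp (- w * (b - a)) * norm (W a)
           + integral {a..b} (\<lambda>s. K * exp (- w * (b - s)) * p s)"
proof -
  have "0 \<le> K * exp (- w * 1)" using bound[of 1] norm_ge_zero[of "T 1"] by linarith
  then have K: "K \<ge> 0" by (simp add: zero_le_mult_iff)
  have bound': "norm (T t) \<le> max 1 K" if "t \<ge> 0" for t
  proof (cases "t = 0")
    case True
    then show ?thesis using T norm_blinfun_id_le by (auto simp: C0_semigroup_def intro: order.trans)
  next
    case False
    then have "norm (T t) \<le> K * exp (- w * t)" using that by (intro bound) simp
    also have "\<dots> \<le> K * 1" using K w that by (intro mult_left_mono) auto
    finally show ?thesis by simp
  qed
  define \<phi> where "\<phi> s = blinfun_apply (T (b - s)) (W s)" for s
  define g where "g s = K * exp (- w * (b - s)) * p s" for s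
  have gc: "continuous_on {a..b} g" unfolding g_def by (intro continuous_intros p)
  have "norm (\<phi> b - \<phi> a) \<le> integral {a..b} g - integral {a..a} g"
  proof (rule right_derivative_bound[where g = g])
    show "a \<le> b" using ab by simp
    show "continuous_on {a..b} \<phi>"
      unfolding \<phi>_def
      by (rule C0_semigroup_continuous_joint[OF T bound' _ _ W]) (auto intro!: continuous_intros)
    show "((\<lambda>x. integral {a..x} g) has_real_derivative g s) (at s within {a..b})" if "s \<in> {a..b}" for s
      by (rule integral_has_real_derivative[OF gc that])
    fix s e :: real assume s: "s \<in> {a..<b}" and e: "e > 0"
    have "((\<lambda>h. (1 / h) *\<^sub>R (W (s + h) - W s) - (1 / h) *\<^sub>R (blinfun_apply (T h) (W s) - W s))
        \<longlongrightarrow> y s + q s - y s) (at_right 0)"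
      using gen[OF s] by (intro tendsto_diff deriv s) (simp add: generator_def)
    then have lim: "((\<lambda>h. (1 / h) *\<^sub>R (W (s + h) - blinfun_apply (T h) (W s))) \<longlongrightarrow> q s) (at_right 0)"
      by (simp add: algebra_simps)
    have "((\<lambda>h. K * exp (- w * (b - s - h)) * norm ((1 / h) *\<^sub>R (W (s + h) - blinfun_apply (T h) (W s))))
       \<longlongrightarrow> K * exp (- w * (b - s - 0)) * norm (q s)) (at_right 0)"
      by (intro tendsto_intros lim)
    moreover have "K * exp (- w * (b - s - 0)) * norm (q s) < g s + e"
      using mult_left_mono[OF q[OF s], of "K * exp (- w * (b - s))"] K e by (simp add: g_def)
    ultimately have 1: "eventually (\<lambda>h. K * exp (- w * (b - s - h))
         * norm ((1 / h) *\<^sub>R (W (s + h) - blinfun_apply (T h) (W s))) < g s + e) (at_right 0)"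
      by (rule order_tendstoD(2))
    have 2: "eventually (\<lambda>h. 0 < h \<and> h < b - s) (at_right 0)"
      using s eventually_at_right_real[of 0 "b - s"] by simp
    show "eventually (\<lambda>h. norm (\<phi> (s + h) - \<phi> s) \<le> h * (g s + e)) (at_right 0)"
      using 1 2
    proof eventually_elim
      case (elim h)
      \<comment> \<open>Factoring out \<open>T (b - s - h)\<close> leaves the defect of \<open>W\<close> against the semigroup, which
         is \<open>h * q s\<close> up to \<open>o(h)\<close>.\<close>
      have "b - s = (b - s - h) + h" by simp
      then have "\<phi> s = blinfun_apply (T (b - s - h)) (blinfun_apply (T h) (W s))"
        unfolding \<phi>_def using C0_semigroup_add[OF T, of "b - s - h" h] elim by simp
      then have "norm (\<phi> (s + h) - \<phi> s)
          = norm (blinfun_apply (T (b - s - h)) (W (s + h) - blinfun_apply (T h) (W s)))"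
        by (simp add: \<phi>_def blinfun.diff_right diff_diff_add)
      also have "\<dots> \<le> norm (T (b - s - h)) * norm (W (s + h) - blinfun_apply (T h) (W s))"
        by (rule norm_blinfun)
      also have "\<dots> \<le> K * exp (- w * (b - s - h)) * norm (W (s + h) - blinfun_apply (T h) (W s))"
        by (intro mult_right_mono bound) (use elim in auto)
      also have "\<dots> = h * (K * exp (- w * (b - s - h))
         * norm ((1 / h) *\<^sub>R (W (s + h) - blinfun_apply (T h) (W s))))"
        using elim by simp
      also have "\<dots> \<le> h * (g s + e)" using elim by (intro mult_left_mono) auto
      finally show ?case .
    qed
  qed
  moreover have "\<phi> b = W b" by (simp add: \<phi>_def C0_semigroup_zero[OF T])
  moreover have "norm (\<phi> a) \<le> K * exp (- w * (b - a)) * norm (W a)"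
    unfolding \<phi>_def using ab
    by (intro order.trans[OF norm_blinfun] mult_right_mono bound) auto
  ultimately show ?thesis
    using norm_triangle_ineq2[of "\<phi> b" "\<phi> a"] by (simp add: g_def[abs_def])
qed

section \<open>Integrals with values in a complete normed space\<close>

text \<open>
  The sort \<open>{real_inner, complete_space}\<close> of the state space is not below the class \<open>banach\<close>, although
  the latter asks for nothing more.  A copy of the type carries the \<open>banach\<close> instance, and the
  isometry between both transports the theory of vector-valued integrals.
\<close>

typedef 'a banach_copy = "UNIV :: 'a set"
  morphisms of_copy to_copy by simp

instantiation banach_copy :: (real_normed_vector) real_normed_vector
begin

definition zero_banach_copy :: "'a banach_copy"
  where "zero_banach_copy = to_copy 0"
definition plus_banach_copy :: "'a banach_copy \<Rightarrow> 'a banach_copy \<Rightarrow> 'a banach_copy"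
  where "plus_banach_copy x y = to_copy (of_copy x + of_copy y)"
definition minus_banach_copy :: "'a banach_copy \<Rightarrow> 'a banach_copy \<Rightarrow> 'a banach_copy"
  where "minus_banach_copy x y = to_copy (of_copy x - of_copy y)"
definition uminus_banach_copy :: "'a banach_copy \<Rightarrow> 'a banach_copy"
  where "uminus_banach_copy x = to_copy (- of_copy x)"
definition scaleR_banach_copy :: "real \<Rightarrow> 'a banach_copy \<Rightarrow> 'a banach_copy"
  where "scaleR_banach_copy c x = to_copy (c *\<^sub>R of_copy x)"
definition norm_banach_copy :: "'a banach_copy \<Rightarrow> real"
  where "norm_banach_copy x = norm (of_copy x)"
definition dist_banach_copy :: "'a banach_copy \<Rightarrow> 'a banach_copy \<Rightarrow> real"
  where "dist_banach_copy x y = norm (x - y)"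
definition sgn_banach_copy :: "'a banach_copy \<Rightarrow> 'a banach_copy"
  where "sgn_banach_copy x = inverse (norm x) *\<^sub>R x"
definition uniformity_banach_copy :: "('a banach_copy \<times> 'a banach_copy) filter"
  where "uniformity_banach_copy = (INF e\<in>{0 <..}. principal {(x, y). dist x y < e})"
definition open_banach_copy :: "'a banach_copy set \<Rightarrow> bool"
  where "open_banach_copy U \<longleftrightarrow>
  (\<forall>x\<in>U. eventually (\<lambda>(x', y). x' = x \<longrightarrow> y \<in> U) uniformity)"

lemmas copy_defs = zero_banach_copy_def plus_banach_copy_def minus_banach_copy_def
  uminus_banach_copy_def scaleR_banach_copy_def norm_banach_copy_def

instance
  by standard (auto simp: copy_defs dist_banach_copy_def sgn_banach_copy_def uniformity_banach_copy_def
       open_banach_copy_def to_copy_inverse to_copy_inject of_copy_inverse algebra_simps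
       scaleR_add_left scaleR_add_right norm_triangle_ineq of_copy_inject[symmetric])

end

lemma dist_of_copy: "dist (of_copy x) (of_copy y) = dist x y"
  unfolding dist_banach_copy_def copy_defs by (simp add: to_copy_inverse dist_norm)

instance banach_copy :: ("{real_normed_vector, complete_space}") banach
proof
  fix X :: "nat \<Rightarrow> 'a banach_copy"
  assume "Cauchy X"
  then have "Cauchy (\<lambda>n. of_copy (X n))"
    by (simp add: Cauchy_def dist_of_copy)
  then obtain l where "(\<lambda>n. of_copy (X n)) \<longlonglongrightarrow> of_copy (to_copy l)"
    by (auto simp: Cauchy_convergent_iff convergent_def to_copy_inverse)
  then have "X \<longlonglongrightarrow> to_copy l"
    unfolding tendsto_iff dist_of_copy .
  then show "convergent X" by (auto simp: convergent_def)
qed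

lemma bounded_linear_to_copy: "bounded_linear (to_copy :: _ \<Rightarrow> 'a::{real_normed_vector, complete_space} banach_copy)"
  by (rule bounded_linear_intro[of _ 1]) (simp_all add: copy_defs to_copy_inverse)

lemma bounded_linear_of_copy: "bounded_linear (of_copy :: 'a::{real_normed_vector, complete_space} banach_copy \<Rightarrow> _)"
  by (rule bounded_linear_intro[of _ 1]) (simp_all add: copy_defs to_copy_inverse)

lemma has_integral_to_copy:
  fixes f :: "'n::euclidean_space \<Rightarrow> 'a::{real_normed_vector, complete_space}"
  shows "((\<lambda>x. to_copy (f x)) has_integral to_copy i) X \<longleftrightarrow> (f has_integral i) X"
  using has_integral_linear[OF _ bounded_linear_to_copy, of f i X]
    has_integral_linear[OF _ bounded_linear_of_copy, of "\<lambda>x. to_copy (f x)" "to_copy i" X]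
  by (auto simp: o_def to_copy_inverse)

lemma integrable_on_to_copy:
  fixes f :: "'n::euclidean_space \<Rightarrow> 'a::{real_normed_vector, complete_space}"
  shows "(\<lambda>x. to_copy (f x)) integrable_on X \<longleftrightarrow> f integrable_on X"
  unfolding integrable_on_def by (metis has_integral_to_copy of_copy_inverse)

lemma integral_to_copy:
  fixes f :: "'n::euclidean_space \<Rightarrow> 'a::{real_normed_vector, complete_space}"
  assumes "f integrable_on X"
  shows "integral X (\<lambda>x. to_copy (f x)) = to_copy (integral X f)"
  using assms by (intro integral_unique) (simp add: has_integral_to_copy integrable_integral)

lemma continuous_integrable:
  fixes f :: "real \<Rightarrow> 'a::{real_normed_vector, complete_space}"
  assumes "continuous_on {a..b} f"
  shows "f integrable_on {a..b}"
  using integrable_continuous_real[OF bounded_linear.continuous_on[OF bounded_linear_to_copy assms]]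
  by (simp add: integrable_on_to_copy)

lemma integrable_join:
  fixes f :: "real \<Rightarrow> 'a::{real_normed_vector, complete_space}"
  assumes "a \<le> c" "c \<le> b" "f integrable_on {a..c}" "f integrable_on {c..b}"
  shows "f integrable_on {a..b}"
  using Henstock_Kurzweil_Integration.integrable_combine[OF assms(1,2), of "\<lambda>x. to_copy (f x)"] assms(3,4)
  by (simp add: integrable_on_to_copy)

lemma integrable_subinterval:
  fixes f :: "real \<Rightarrow> 'a::{real_normed_vector, complete_space}"
  assumes "f integrable_on {a..b}" "{c..d} \<subseteq> {a..b}"
  shows "f integrable_on {c..d}"
  using integrable_subinterval_real[of "\<lambda>x. to_copy (f x)" a b c d] assms
  by (simp add: integrable_on_to_copy)

lemma integral_join:
  fixes f :: "real \<Rightarrow> 'a::{real_normed_vector, complete_space}"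
  assumes "a \<le> c" "c \<le> b" "f integrable_on {a..b}"
  shows "integral {a..c} f + integral {c..b} f = integral {a..b} f"
proof -
  have "f integrable_on {a..c}" "f integrable_on {c..b}"
    using assms by (auto intro: integrable_subinterval)
  then have "to_copy (integral {a..c} f) + to_copy (integral {c..b} f) = to_copy (integral {a..b} f)"
    using Henstock_Kurzweil_Integration.integral_combine[OF assms(1,2), of "\<lambda>x. to_copy (f x)"] assms(3)
    by (simp add: integral_to_copy integrable_on_to_copy)
  then show ?thesis by (simp add: copy_defs to_copy_inverse to_copy_inject)
qed

lemma norm_integral_le:
  fixes f :: "real \<Rightarrow> 'a::{real_normed_vector, complete_space}"
  assumes "f integrable_on X" "g integrable_on X" "\<And>x. x \<in> X \<Longrightarrow> norm (f x) \<le> g x"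
  shows "norm (integral X f) \<le> integral X g"
  using Henstock_Kurzweil_Integration.integral_norm_bound_integral[of "\<lambda>x. to_copy (f x)" X g] assms
  by (simp add: integral_to_copy integrable_on_to_copy norm_banach_copy_def to_copy_inverse)

lemma norm_integral_diff_le:
  fixes f :: "real \<Rightarrow> 'a::{real_normed_vector, complete_space}"
  assumes f: "f integrable_on {a..b}" and ab: "a \<le> b" and e: "\<And>x. x \<in> {a..b} \<Longrightarrow> norm (f x - c) \<le> e"
  shows "norm (integral {a..b} f - (b - a) *\<^sub>R c) \<le> (b - a) * e"
proof -
  have c: "((\<lambda>x. c) has_integral (b - a) *\<^sub>R c) {a..b}"
    using has_integral_const_real[of c a b] ab by simp
  then have "integral {a..b} f - (b - a) *\<^sub>R c = integral {a..b} (\<lambda>x. f x - c)"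
    using f by (subst integral_diff) (auto simp: integral_unique[OF c] has_integral_integrable)
  also have "norm \<dots> \<le> integral {a..b} (\<lambda>x. e)"
    using f c by (intro norm_integral_le e integrable_diff) (auto simp: has_integral_integrable)
  finally show ?thesis using ab by simp
qed

lemma indefinite_integral_has_vector_derivative:
  fixes f :: "real \<Rightarrow> 'a::{real_normed_vector, complete_space}"
  assumes f: "continuous_on {a..b} f" and x: "x \<in> {a..b}"
  shows "((\<lambda>t. integral {a..t} f) has_vector_derivative f x) (at x within {a..b})"
proof -
  have "((\<lambda>t. integral {a..t} (\<lambda>s. to_copy (f s))) has_vector_derivative to_copy (f x)) (at x within {a..b})"
    by (rule integral_has_vector_derivative[OF bounded_linear.continuous_on[OF bounded_linear_to_copy f] x])
  then have "((\<lambda>t. of_copy (integral {a..t} (\<lambda>s. to_copy (f s)))) has_vector_derivative of_copy (to_copy (f x)))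
      (at x within {a..b})"
    by (rule bounded_linear.has_vector_derivative[OF bounded_linear_of_copy])
  then have D: "((\<lambda>t. of_copy (integral {a..t} (\<lambda>s. to_copy (f s)))) has_vector_derivative f x) (at x within {a..b})"
    by (simp add: to_copy_inverse)
  have "of_copy (integral {a..t} (\<lambda>s. to_copy (f s))) = integral {a..t} f" if "t \<in> {a..b}" for t
  proof -
    have "f integrable_on {a..t}"
      using that by (intro continuous_integrable continuous_on_subset[OF f]) auto
    then show ?thesis by (simp add: integral_to_copy to_copy_inverse)
  qed
  from has_vector_derivative_transform[OF x this[symmetric] D] show ?thesis by simp
qed

lemma has_integral_vector_derivative:
  fixes f :: "real \<Rightarrow> 'a::{real_normed_vector, complete_space}"
  assumes ab: "a \<le> b"
    and f: "\<And>x. x \<in> {a..b} \<Longrightarrow> (f has_vector_derivative f' x) (at x within {a..b})"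
  shows "(f' has_integral (f b - f a)) {a..b}"
proof -
  have "((\<lambda>x. to_copy (f' x)) has_integral (to_copy (f b) - to_copy (f a))) {a..b}"
    by (rule fundamental_theorem_of_calculus[OF ab bounded_linear.has_vector_derivative[OF bounded_linear_to_copy f]])
  then show ?thesis
    by (simp add: has_integral_to_copy linear_diff[OF bounded_linear.linear[OF bounded_linear_to_copy], symmetric])
qed

text \<open>
  The difference quotient is a mean of \<open>v\<close> over \<open>{r..r + h}\<close>, and \<open>v\<close> is uniformly
  continuous on compact intervals.  Uniformity in \<open>r\<close> is what makes the delayed history, a whole
  segment of the curve, differentiable in \<open>L\<^sup>2\<close>.
\<close>

lemma difference_quotient_uniform:
  fixes u :: "real \<Rightarrow> 'a::{real_normed_vector, complete_space}"
  assumes u: "\<And>r. (u has_vector_derivative v r) (at r)" and v: "continuous_on UNIV v" and e: "e > 0"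
  shows "eventually (\<lambda>h. \<forall>r\<in>{a..b}. norm ((1 / h) *\<^sub>R (u (r + h) - u r) - v r) \<le> e) (at_right 0)"
proof -
  have "uniformly_continuous_on {a..b + 1} v"
    by (intro compact_uniformly_continuous continuous_on_subset[OF v]) auto
  then obtain d where d: "d > 0"
      "\<And>r s. r \<in> {a..b + 1} \<Longrightarrow> s \<in> {a..b + 1} \<Longrightarrow> dist r s < d \<Longrightarrow> dist (v r) (v s) < e"
    using e unfolding uniformly_continuous_on_def by metis
  have "eventually (\<lambda>h. 0 < h \<and> h < min 1 d) (at_right 0)"
    using eventually_at_right_real[of 0 "min 1 d"] d(1) by simp
  then show ?thesis
  proof eventually_elim
    case (elim h)
    show ?case
    proof
      fix r assume r: "r \<in> {a..b}"
      have i: "(v has_integral (u (r + h) - u r)) {r..r + h}"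
        using elim by (intro has_integral_vector_derivative has_vector_derivative_at_within[OF u]) simp
      have "norm (v s - v r) \<le> e" if "s \<in> {r..r + h}" for s
        using d(2)[of s r] that r elim by (auto simp: dist_norm less_imp_le)
      then have "norm (integral {r..r + h} v - (r + h - r) *\<^sub>R v r) \<le> (r + h - r) * e"
        using i elim by (intro norm_integral_diff_le) (auto simp: has_integral_integrable)
      then have "norm (u (r + h) - u r - h *\<^sub>R v r) \<le> h * e"
        by (simp add: integral_unique[OF i])
      then have "(1 / h) * norm (u (r + h) - u r - h *\<^sub>R v r) \<le> e"
        using elim by (simp add: divide_le_eq mult.commute)
      also have "(1 / h) * norm (u (r + h) - u r - h *\<^sub>R v r)
          = norm ((1 / h) *\<^sub>R (u (r + h) - u r - h *\<^sub>R v r))"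
        using elim by simp
      also have "\<dots> = norm ((1 / h) *\<^sub>R (u (r + h) - u r) - v r)"
        using elim by (simp add: scaleR_diff_right)
      finally show "norm ((1 / h) *\<^sub>R (u (r + h) - u r) - v r) \<le> e" .
    qed
  qed
qed

lemma difference_quotient_tendsto:
  fixes u :: "real \<Rightarrow> 'a::{real_normed_vector, complete_space}"
  assumes "\<And>r. (u has_vector_derivative v r) (at r)" "continuous_on UNIV v"
  shows "((\<lambda>h. (1 / h) *\<^sub>R (u (t + h) - u t)) \<longlongrightarrow> v t) (at_right 0)"
proof (rule tendstoI)
  fix e :: real assume e: "e > 0"
  then have "eventually (\<lambda>h. \<forall>r\<in>{t..t}. norm ((1 / h) *\<^sub>R (u (r + h) - u r) - v r) \<le> e / 2) (at_right 0)"
    by (intro difference_quotient_uniform assms) simp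
  then show "eventually (\<lambda>h. dist ((1 / h) *\<^sub>R (u (t + h) - u t)) (v t) < e) (at_right 0)"
    by eventually_elim (use e in \<open>simp add: dist_norm\<close>)
qed

section \<open>Gronwall inequality\<close>

lemma gronwall:
  fixes y :: "real \<Rightarrow> real"
  assumes y: "continuous_on {a..b} y" and q: "q \<ge> 0"
    and le: "\<And>t. t \<in> {a..b} \<Longrightarrow> y t \<le> A + q * integral {a..t} y" and t: "t \<in> {a..b}"
  shows "y t \<le> A * exp (q * (t - a))"
proof -
  define P where "P s = (A + q * integral {a..s} y) * exp (- q * (s - a))" for s
  have D: "(P has_real_derivative (q * y s - q * (A + q * integral {a..s} y)) * exp (- q * (s - a)))
      (at s within {a..b})" if "s \<in> {a..b}" for s
    unfolding P_def
    by (rule derivative_eq_intros refl integral_has_real_derivative[OF y that])+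
       (simp add: algebra_simps)
  have "P t \<le> P a"
  proof (cases "a < t")
    case True
    show ?thesis
    proof (rule DERIV_nonpos_imp_decreasing_open[OF less_imp_le[OF True]])
      show "\<exists>y. (P has_real_derivative y) (at s) \<and> y \<le> 0" if "a < s" "s < t" for s
      proof (intro exI conjI)
        show "(P has_real_derivative (q * y s - q * (A + q * integral {a..s} y)) * exp (- q * (s - a))) (at s)"
          using D[of s] that t by (simp add: at_within_Icc_at)
        show "(q * y s - q * (A + q * integral {a..s} y)) * exp (- q * (s - a)) \<le> 0"
          using le[of s] that t q by (intro mult_nonpos_nonneg) (auto intro: mult_left_mono)
      qed
      have "continuous_on {a..b} P"
        using D by (meson DERIV_continuous continuous_on_eq_continuous_within)
      then show "continuous_on {a..t} P"
        by (rule continuous_on_subset) (use t in auto)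
    qed
  qed (use t in auto)
  then have "P t * exp (q * (t - a)) \<le> A * exp (q * (t - a))"
    by (simp add: P_def)
  then have "A + q * integral {a..t} y \<le> A * exp (q * (t - a))"
    by (simp add: P_def mult.assoc exp_add[symmetric])
  then show ?thesis using le[OF t] by linarith
qed

section \<open>Averages of mild solutions\<close>

text \<open>
  Averaging over a short interval to the right regularises a mild solution: the averaged curve is
  continuously differentiable and takes values in the domain of the generator.
\<close>

definition average :: "real \<Rightarrow> (real \<Rightarrow> 'a::real_normed_vector) \<Rightarrow> real \<Rightarrow> 'a" where
  "average \<epsilon> u t = (1 / \<epsilon>) *\<^sub>R integral {t..t + \<epsilon>} u"

lemma average_close:
  fixes u :: "real \<Rightarrow> 'a::{real_normed_vector, complete_space}"
  assumes u: "u integrable_on {t..t + \<epsilon>}" and \<epsilon>: "\<epsilon> > 0"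
    and e: "\<And>r. r \<in> {t..t + \<epsilon>} \<Longrightarrow> norm (u r - c) \<le> e"
  shows "norm (average \<epsilon> u t - c) \<le> e"
proof -
  have "norm (integral {t..t + \<epsilon>} u - \<epsilon> *\<^sub>R c) \<le> \<epsilon> * e"
    using norm_integral_diff_le[OF u _ e] \<epsilon> by simp
  then have "(1 / \<epsilon>) * norm (integral {t..t + \<epsilon>} u - \<epsilon> *\<^sub>R c) \<le> e"
    using \<epsilon> by (simp add: field_simps)
  also have "(1 / \<epsilon>) * norm (integral {t..t + \<epsilon>} u - \<epsilon> *\<^sub>R c) = norm ((1 / \<epsilon>) *\<^sub>R (integral {t..t + \<epsilon>} u - \<epsilon> *\<^sub>R c))"
    using \<epsilon> by simp
  also have "\<dots> = norm (average \<epsilon> u t - c)"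
    using \<epsilon> by (simp add: average_def scaleR_diff_right)
  finally show ?thesis .
qed

lemma average_bounded_linear:
  assumes "bounded_linear L" "u integrable_on {t..t + \<epsilon>}"
  shows "average \<epsilon> (\<lambda>r. L (u r)) t = L (average \<epsilon> u t)"
  using integral_linear[OF assms(2,1)] linear_scale[OF bounded_linear.linear[OF assms(1)]]
  by (simp add: average_def o_def)

lemma average_add:
  assumes "u integrable_on {t..t + \<epsilon>}" "v integrable_on {t..t + \<epsilon>}"
  shows "average \<epsilon> (\<lambda>r. u r + v r) t = average \<epsilon> u t + average \<epsilon> v t"
  using assms by (simp add: average_def integral_add scaleR_add_right)

lemma average_diff:
  assumes "u integrable_on {t..t + \<epsilon>}" "v integrable_on {t..t + \<epsilon>}"
  shows "average \<epsilon> (\<lambda>r. u r - v r) t = average \<epsilon> u t - average \<epsilon> v t"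
  using assms by (simp add: average_def integral_diff scaleR_diff_right)

lemma average_shift: "average \<epsilon> (\<lambda>r. u (r + c)) t = average \<epsilon> u (t + c)"
  using integral_shift_real_ivl[of "t + c" c "t + c + \<epsilon>" u] by (simp add: average_def algebra_simps)

lemma average_has_vector_derivative:
  fixes u :: "real \<Rightarrow> 'a::{real_normed_vector, complete_space}"
  assumes u: "continuous_on UNIV u" and \<epsilon>: "\<epsilon> > 0"
  shows "(average \<epsilon> u has_vector_derivative (1 / \<epsilon>) *\<^sub>R (u (t + \<epsilon>) - u t)) (at t)"
proof -
  define a b where "a = t - 1" and "b = t + \<epsilon> + 1"
  define P where "P x = integral {a..x} u" for x
  have uc: "continuous_on X u" for X by (rule continuous_on_subset[OF u]) simp
  have P: "(P has_vector_derivative u x) (at x)" if "a < x" "x < b" for x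
    using indefinite_integral_has_vector_derivative[OF uc, of x a b] that
    by (simp add: P_def[abs_def] at_within_Icc_at)
  have shift: "((\<lambda>x. P (x + \<epsilon>)) has_vector_derivative u (t + \<epsilon>)) (at t)"
  proof -
    have "((\<lambda>x. x + \<epsilon>) has_vector_derivative 1) (at t)"
      by (auto intro!: derivative_eq_intros)
    from vector_diff_chain_at[OF this P[of "t + \<epsilon>"]] \<epsilon> show ?thesis
      by (simp add: o_def a_def b_def)
  qed
  have D: "((\<lambda>x. (1 / \<epsilon>) *\<^sub>R (P (x + \<epsilon>) - P x)) has_vector_derivative
      (1 / \<epsilon>) *\<^sub>R (u (t + \<epsilon>) - u t)) (at t)"
  proof -
    have "(P has_vector_derivative u t) (at t)" using \<epsilon> by (intro P) (auto simp: a_def b_def)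
    then show ?thesis
      by (intro bounded_linear.has_vector_derivative[OF bounded_linear_scaleR_right]
            has_vector_derivative_diff shift)
  qed
  have eq: "(1 / \<epsilon>) *\<^sub>R (P (x + \<epsilon>) - P x) = average \<epsilon> u x" if "x \<in> {a<..}" for x
  proof -
    have "P x + integral {x..x + \<epsilon>} u = P (x + \<epsilon>)"
      unfolding P_def using that \<epsilon> by (intro integral_join continuous_integrable uc) auto
    then have "P (x + \<epsilon>) - P x = integral {x..x + \<epsilon>} u" by (simp add: algebra_simps)
    then show ?thesis by (simp add: average_def)
  qed
  show ?thesis
    by (rule has_vector_derivative_transform_within_open[OF D open_greaterThan[of a] _ eq]) (simp_all add: a_def)
qed

lemma continuous_average:
  fixes u :: "real \<Rightarrow> 'a::{real_normed_vector, complete_space}"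
  assumes "continuous_on UNIV u" "\<epsilon> > 0"
  shows "continuous_on X (average \<epsilon> u)"
  using average_has_vector_derivative[OF assms]
  by (meson continuous_at_imp_continuous_on has_vector_derivative_continuous)

lemma average_uniformly_close:
  fixes u :: "real \<Rightarrow> 'a::{real_normed_vector, complete_space}"
  assumes u: "continuous_on UNIV u" and \<delta>: "\<delta> > 0"
  obtains d where "d > 0" "\<And>\<epsilon> s. 0 < \<epsilon> \<Longrightarrow> \<epsilon> < d \<Longrightarrow> s \<in> {a..b} \<Longrightarrow> norm (average \<epsilon> u s - u s) \<le> \<delta>"
proof -
  have "uniformly_continuous_on {a..b + 1} u"
    by (intro compact_uniformly_continuous continuous_on_subset[OF u]) auto
  then obtain d where d: "d > 0"
      "\<And>r r'. r \<in> {a..b + 1} \<Longrightarrow> r' \<in> {a..b + 1} \<Longrightarrow> dist r r' < d \<Longrightarrow> dist (u r) (u r') < \<delta>"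
    using \<delta> unfolding uniformly_continuous_on_def by metis
  show ?thesis
  proof (rule that[of "min 1 d"])
    fix \<epsilon> s assume *: "0 < \<epsilon>" "\<epsilon> < min 1 d" "s \<in> {a..b}"
    show "norm (average \<epsilon> u s - u s) \<le> \<delta>"
    proof (rule average_close)
      show "u integrable_on {s..s + \<epsilon>}"
        by (intro continuous_integrable continuous_on_subset[OF u]) simp
      fix r assume "r \<in> {s..s + \<epsilon>}"
      then show "norm (u r - u s) \<le> \<delta>"
        using d(2)[of r s] * by (auto simp: dist_norm less_imp_le)
    qed (use * in simp)
  qed (use d in simp)
qed

text \<open>
  The integrand \<open>S (s + h - r) (g r)\<close> is jointly continuous in the elapsed time and in \<open>r\<close>, hence
  uniformly close to its value \<open>g s\<close> at elapsed time 0.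
\<close>

lemma short_convolution_uniform_limit:
  fixes S :: "real \<Rightarrow> 'a::{real_normed_vector, complete_space} \<Rightarrow>\<^sub>L 'a"
  assumes S: "C0_semigroup S" and bound: "\<And>t. t \<ge> 0 \<Longrightarrow> norm (S t) \<le> K"
    and g: "continuous_on UNIV g" and e: "e > 0"
  shows "eventually (\<lambda>h. \<forall>s\<in>{a..b}.
    norm ((1 / h) *\<^sub>R integral {s..s + h} (\<lambda>r. blinfun_apply (S (s + h - r)) (g r)) - g s) \<le> e) (at_right 0)"
proof -
  define \<Phi> where "\<Phi> p = blinfun_apply (S (fst p)) (g (snd p))" for p
  have \<Phi>: "continuous_on ({0..1} \<times> {a..b + 1}) \<Phi>"
    unfolding \<Phi>_def
    by (rule C0_semigroup_continuous_joint[OF S bound])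
       (auto intro!: continuous_intros continuous_on_compose2[OF g])
  have "uniformly_continuous_on ({0..1} \<times> {a..b + 1}) \<Phi>"
    by (intro compact_uniformly_continuous \<Phi> compact_Times compact_Icc)
  then obtain d where d: "d > 0" "\<And>p q. p \<in> {0..1} \<times> {a..b + 1} \<Longrightarrow> q \<in> {0..1} \<times> {a..b + 1} \<Longrightarrow>
      dist p q < d \<Longrightarrow> dist (\<Phi> p) (\<Phi> q) < e"
    using e unfolding uniformly_continuous_on_def by metis
  have "eventually (\<lambda>h. 0 < h \<and> h < min 1 d) (at_right 0)"
    using eventually_at_right_real[of 0 "min 1 d"] d(1) by simp
  then show ?thesis
  proof eventually_elim
    case (elim h)
    show ?case
    proof
      fix s assume s: "s \<in> {a..b}"
      define f where "f r = blinfun_apply (S (s + h - r)) (g r)" for r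
      have "continuous_on {s..s + h} f"
        unfolding f_def
        by (rule C0_semigroup_continuous_joint[OF S bound])
           (auto intro!: continuous_intros continuous_on_subset[OF g])
      then have f: "f integrable_on {s..s + h}" by (rule continuous_integrable)
      have "norm (f r - g s) \<le> e" if r: "r \<in> {s..s + h}" for r
      proof -
        have "dist (s + h - r, r) (0, s) \<le> \<bar>s + h - r\<bar> + \<bar>r - s\<bar>"
          using sqrt_sum_squares_le_sum_abs[of "s + h - r" "r - s"]
          by (simp add: dist_Pair_Pair dist_real_def)
        also have "\<dots> < d" using r elim by simp
        finally have "dist (\<Phi> (s + h - r, r)) (\<Phi> (0, s)) < e"
          using r s elim by (intro d(2)) auto
        then show ?thesis
          by (simp add: \<Phi>_def f_def C0_semigroup_zero[OF S] dist_norm)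
      qed
      then have "norm (average h f s - g s) \<le> e"
        using elim by (intro average_close f) auto
      then show "norm ((1 / h) *\<^sub>R integral {s..s + h} (\<lambda>r. blinfun_apply (S (s + h - r)) (g r)) - g s) \<le> e"
        by (simp add: average_def f_def[abs_def])
    qed
  qed
qed

text \<open>
  Integrated solutions of \<open>u' = A u + g\<close> solve the equation in the strong sense:
  averaging \<open>S h (u s) = u (s + h) - \<integral> S (s + h - r) (g r) dr\<close> over \<open>s\<close> shows that
  \<open>(S h - 1) / h\<close> applied to the average is a difference quotient of the average minus a short
  convolution, and both converge as \<open>h\<close> tends to 0.
\<close>

lemma average_in_generator:
  fixes S :: "real \<Rightarrow> 'a::{real_normed_vector, complete_space} \<Rightarrow>\<^sub>L 'a"
  assumes S: "C0_semigroup S" and bound: "\<And>t. t \<ge> 0 \<Longrightarrow> norm (S t) \<le> K"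
    and u: "continuous_on UNIV u" and g: "continuous_on UNIV g" and \<epsilon>: "\<epsilon> > 0"
    and mild: "\<And>s h. s \<ge> t \<Longrightarrow> h \<ge> 0 \<Longrightarrow> u (s + h) = blinfun_apply (S h) (u s)
       + integral {s..s + h} (\<lambda>r. blinfun_apply (S (s + h - r)) (g r))"
  shows "(average \<epsilon> u t, (1 / \<epsilon>) *\<^sub>R (u (t + \<epsilon>) - u t) - average \<epsilon> g t) \<in> generator S"
proof -
  define I where "I h s = integral {s..s + h} (\<lambda>r. blinfun_apply (S (s + h - r)) (g r))" for h s
  have ui: "u integrable_on {x..y}" and gi: "g integrable_on {x..y}"
    and ush: "(\<lambda>s. u (s + h)) integrable_on {x..y}" for x y h
    by (auto intro!: continuous_integrable continuous_on_subset[OF u] continuous_on_subset[OF g]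
          continuous_on_compose2[OF u] continuous_intros)
  have Su: "(\<lambda>s. blinfun_apply (S h) (u s)) integrable_on {x..y}" for x y h
    using integrable_linear[OF ui blinfun.bounded_linear_right] by (simp add: o_def)
  have split: "(1 / h) *\<^sub>R (blinfun_apply (S h) (average \<epsilon> u t) - average \<epsilon> u t)
      = (1 / h) *\<^sub>R (average \<epsilon> u (t + h) - average \<epsilon> u t) - (1 / h) *\<^sub>R average \<epsilon> (I h) t"
    and Ii: "I h integrable_on {t..t + \<epsilon>}" if "h > 0" for h
  proof -
    have I: "I h s = u (s + h) - blinfun_apply (S h) (u s)" if "s \<in> {t..t + \<epsilon>}" for s
      using mild[of s h] that \<open>h > 0\<close> by (simp add: I_def)
    have "(\<lambda>s. u (s + h) - blinfun_apply (S h) (u s)) integrable_on {t..t + \<epsilon>}"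
      by (intro integrable_diff ush Su)
    then show "I h integrable_on {t..t + \<epsilon>}"
      by (rule integrable_eq) (simp add: I)
    have "average \<epsilon> (I h) t = average \<epsilon> (\<lambda>s. u (s + h) - blinfun_apply (S h) (u s)) t"
      unfolding average_def by (intro arg_cong[of _ _ "\<lambda>x. (1 / \<epsilon>) *\<^sub>R x"] integral_cong I)
    also have "\<dots> = average \<epsilon> u (t + h) - blinfun_apply (S h) (average \<epsilon> u t)"
      by (simp add: average_diff[OF ush Su] average_shift
            average_bounded_linear[OF blinfun.bounded_linear_right ui])
    finally show "(1 / h) *\<^sub>R (blinfun_apply (S h) (average \<epsilon> u t) - average \<epsilon> u t)
      = (1 / h) *\<^sub>R (average \<epsilon> u (t + h) - average \<epsilon> u t) - (1 / h) *\<^sub>R average \<epsilon> (I h) t"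
      by (simp add: scaleR_diff_right)
  qed
  have "((\<lambda>h. (1 / h) *\<^sub>R (average \<epsilon> u (t + h) - average \<epsilon> u t)) \<longlongrightarrow> (1 / \<epsilon>) *\<^sub>R (u (t + \<epsilon>) - u t)) (at_right 0)"
    by (rule difference_quotient_tendsto[OF average_has_vector_derivative[OF u \<epsilon>]])
       (auto intro!: continuous_intros continuous_on_compose2[OF u])
  moreover have "((\<lambda>h. (1 / h) *\<^sub>R average \<epsilon> (I h) t) \<longlongrightarrow> average \<epsilon> g t) (at_right 0)"
  proof (rule tendstoI)
    fix e :: real assume e: "e > 0"
    have "eventually (\<lambda>h. h > 0) (at_right (0::real))" by (simp add: eventually_at_right_less)
    moreover have "eventually (\<lambda>h. \<forall>s\<in>{t..t + \<epsilon>}. norm ((1 / h) *\<^sub>R I h s - g s) \<le> e / 2) (at_right 0)"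
      unfolding I_def using e by (intro short_convolution_uniform_limit[OF S bound g]) auto
    ultimately show "eventually (\<lambda>h. dist ((1 / h) *\<^sub>R average \<epsilon> (I h) t) (average \<epsilon> g t) < e) (at_right 0)"
    proof eventually_elim
      case (elim h)
      have Ih: "(\<lambda>s. (1 / h) *\<^sub>R I h s) integrable_on {t..t + \<epsilon>}"
        using Ii[OF elim(1)] by (rule integrable_cmul)
      have "norm (average \<epsilon> (\<lambda>s. (1 / h) *\<^sub>R I h s - g s) t - 0) \<le> e / 2"
        using elim(2) by (intro average_close \<epsilon> integrable_diff gi Ih) auto
      also have "average \<epsilon> (\<lambda>s. (1 / h) *\<^sub>R I h s - g s) t = (1 / h) *\<^sub>R average \<epsilon> (I h) t - average \<epsilon> g t"
        by (simp add: average_diff[OF Ih gi] average_bounded_linear[OF bounded_linear_scaleR_right Ii[OF elim(1)]])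
      finally show ?case using e by (simp add: dist_norm)
    qed
  qed
  ultimately have "((\<lambda>h. (1 / h) *\<^sub>R (average \<epsilon> u (t + h) - average \<epsilon> u t) - (1 / h) *\<^sub>R average \<epsilon> (I h) t)
     \<longlongrightarrow> (1 / \<epsilon>) *\<^sub>R (u (t + \<epsilon>) - u t) - average \<epsilon> g t) (at_right 0)"
    by (rule tendsto_diff)
  then show ?thesis
    unfolding generator_def mem_Collect_eq case_prod_conv
    by (rule Lim_transform_eventually)
       (use split in \<open>auto intro!: eventually_mono[OF eventually_at_right_less[of "0::real"]]\<close>)
qed

text \<open>
  The mild formula can be restarted at any time, because \<open>S h\<close> passes under the integral.
\<close>

lemma mild_formula_step:
  fixes S :: "real \<Rightarrow> 'a::{real_normed_vector, complete_space} \<Rightarrow>\<^sub>L 'a"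
  assumes S: "C0_semigroup S"
    and int: "\<And>t. t \<ge> 0 \<Longrightarrow> (\<lambda>r. blinfun_apply (S (t - r)) (g r)) integrable_on {0..t}"
    and mild: "\<And>t. t \<ge> 0 \<Longrightarrow> u t = blinfun_apply (S t) u0
       + integral {0..t} (\<lambda>r. blinfun_apply (S (t - r)) (g r))"
    and s: "s \<ge> 0" and h: "h \<ge> 0"
  shows "u (s + h) = blinfun_apply (S h) (u s)
       + integral {s..s + h} (\<lambda>r. blinfun_apply (S (s + h - r)) (g r))"
proof -
  have "blinfun_apply (S h) (integral {0..s} (\<lambda>r. blinfun_apply (S (s - r)) (g r)))
      = integral {0..s} (blinfun_apply (S h) \<circ> (\<lambda>r. blinfun_apply (S (s - r)) (g r)))"
    by (rule integral_linear[OF int[OF s] blinfun.bounded_linear_right, symmetric])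
  also have "\<dots> = integral {0..s} (\<lambda>r. blinfun_apply (S (s + h - r)) (g r))"
  proof (rule integral_cong)
    fix r assume "r \<in> {0..s}"
    then show "(blinfun_apply (S h) \<circ> (\<lambda>r. blinfun_apply (S (s - r)) (g r))) r = blinfun_apply (S (s + h - r)) (g r)"
      using C0_semigroup_add[OF S h, of "s - r" "g r"] by (simp add: algebra_simps)
  qed
  finally have "blinfun_apply (S h) (u s) = blinfun_apply (S (s + h)) u0
      + integral {0..s} (\<lambda>r. blinfun_apply (S (s + h - r)) (g r))"
    using C0_semigroup_add[OF S h s, of u0] by (simp add: mild[OF s] blinfun.add_right add.commute)
  then show ?thesis
    using mild[of "s + h"] integral_join[OF s _ int, of "s + h"] s h by (simp add: add.assoc)
qed

section \<open>Continuous functions as elements of the space of square integrable functions\<close>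

text \<open>
  The step functions freeze the argument at the left end of the cell of a grid of width
  \<open>1 / (i + 1)\<close>.
\<close>

lemma strongly_measurable_continuous:
  fixes z :: "real \<Rightarrow> 'a::real_normed_vector"
  assumes z: "continuous_on {0..1} z"
  shows "strongly_measurable unit_leb z"
  unfolding strongly_measurable_def
proof (intro exI conjI allI)
  fix i :: nat
  have "finite ((\<lambda>x. \<lfloor>real (Suc i) * x\<rfloor>) ` space unit_leb)"
  proof (rule finite_subset[of _ "{0..int (Suc i)}"])
    have "\<lfloor>real (Suc i) * x\<rfloor> \<in> {0..int (Suc i)}" if "x \<in> {0<..<1}" for x
    proof -
      have "real (Suc i) * x \<le> real (Suc i) * 1" using that by (intro mult_left_mono) auto
      then have "\<lfloor>real (Suc i) * x\<rfloor> \<le> \<lfloor>real (Suc i)\<rfloor>" by (intro floor_mono) simp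
      then show ?thesis using that by (simp del: of_nat_Suc)
    qed
    then show "(\<lambda>x. \<lfloor>real (Suc i) * x\<rfloor>) ` space unit_leb \<subseteq> {0..int (Suc i)}" by auto
  qed simp
  moreover have "(\<lambda>x::real. \<lfloor>real (Suc i) * x\<rfloor>) \<in> measurable lebesgue (count_space UNIV)"
    by (rule measurable_completion) measurable
  then have "(\<lambda>x. \<lfloor>real (Suc i) * x\<rfloor>) \<in> measurable unit_leb (count_space UNIV)"
    by (rule measurable_restrict_space1)
  ultimately have "simple_function unit_leb (\<lambda>x. \<lfloor>real (Suc i) * x\<rfloor>)"
    by (simp add: simple_function_eq_measurable)
  then show "simple_function unit_leb (\<lambda>x. z (of_int \<lfloor>real (Suc i) * x\<rfloor> / real (Suc i)))"
    by (rule simple_function_compose1)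
next
  have "(\<lambda>i. z (of_int \<lfloor>real (Suc i) * x\<rfloor> / real (Suc i))) \<longlonglongrightarrow> z x" if x: "x \<in> {0<..<1}" for x
  proof -
    have up: "of_int \<lfloor>real (Suc i) * x\<rfloor> / real (Suc i) \<le> x" for i
      by (simp add: divide_le_eq mult.commute del: of_nat_Suc)
    have low: "x - inverse (real (Suc i)) \<le> of_int \<lfloor>real (Suc i) * x\<rfloor> / real (Suc i)" for i
    proof -
      have "real (Suc i) * x - 1 \<le> of_int \<lfloor>real (Suc i) * x\<rfloor>" by linarith
      then have "(real (Suc i) * x - 1) / real (Suc i) \<le> of_int \<lfloor>real (Suc i) * x\<rfloor> / real (Suc i)"
        by (rule divide_right_mono) simp
      then show ?thesis by (simp add: diff_divide_distrib inverse_eq_divide del: of_nat_Suc)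
    qed
    have "(\<lambda>i. of_int \<lfloor>real (Suc i) * x\<rfloor> / real (Suc i)) \<longlonglongrightarrow> x"
    proof (rule tendsto_sandwich)
      show "(\<lambda>i. x - inverse (real (Suc i))) \<longlonglongrightarrow> x"
        using tendsto_diff[OF tendsto_const[of x] LIMSEQ_inverse_real_of_nat] by simp
      show "(\<lambda>i. x) \<longlonglongrightarrow> x" by simp
    qed (intro always_eventually allI low up)+
    moreover have "isCont z x"
      using z x by (simp add: continuous_on_interior)
    ultimately show ?thesis by (rule isCont_tendsto_compose[rotated])
  qed
  then show "AE x in unit_leb. (\<lambda>i. z (of_int \<lfloor>real (Suc i) * x\<rfloor> / real (Suc i))) \<longlonglongrightarrow> z x"
    by (intro AE_I2) auto
qed

lemma square_integrable_continuous:
  assumes z: "continuous_on {0..1} z"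
  shows "square_integrable z"
  unfolding square_integrable_def
proof
  have "(\<lambda>x. (norm (z x))\<^sup>2) absolutely_integrable_on {0..1}"
    by (intro absolutely_integrable_continuous_real continuous_intros z)
  then have "(\<lambda>x. (norm (z x))\<^sup>2) absolutely_integrable_on {0<..<1}"
    by (rule set_integrable_subset) auto
  then show "integrable unit_leb (\<lambda>x. (norm (z x))\<^sup>2)"
    by (simp add: integrable_restrict_space set_integrable_def)
qed (rule strongly_measurable_continuous[OF z])

lemma L2_rel_continuous: "continuous_on {0..1} z \<Longrightarrow> L2_rel z z"
  by (simp add: L2_rel_def square_integrable_continuous)

lemma norm_abs_L2_le:
  assumes z: "continuous_on {0..1} z" and c: "\<And>x. x \<in> {0<..<1} \<Longrightarrow> norm (z x) \<le> c"
  shows "norm (abs_L2 z) \<le> c"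
proof -
  have c0: "c \<ge> 0" using order.trans[OF norm_ge_zero c[of "1/2"]] by simp
  have fin: "emeasure unit_leb (space unit_leb) = 1"
    by (simp add: emeasure_restrict_space)
  have "integral\<^sup>L unit_leb (\<lambda>x. z x \<bullet> z x) \<le> integral\<^sup>L unit_leb (\<lambda>x. c\<^sup>2)"
  proof (rule integral_mono)
    show "integrable unit_leb (\<lambda>x. z x \<bullet> z x)"
      using square_integrable_continuous[OF z] by (intro square_integrable_inner)
    show "integrable unit_leb (\<lambda>x. c\<^sup>2)"
      using fin by (intro finite_measure.integrable_const finite_measureI) simp
    show "z x \<bullet> z x \<le> c\<^sup>2" if "x \<in> space unit_leb" for x
      using c[of x] that by (auto simp: power2_norm_eq_inner[symmetric] intro: power_mono)
  qed
  also have "\<dots> = c\<^sup>2" using fin by (simp add: measure_def)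
  finally have "sqrt (abs_L2 z \<bullet> abs_L2 z) \<le> sqrt (c\<^sup>2)"
    unfolding inner_L2.abs_eq[OF L2_rel_continuous[OF z] L2_rel_continuous[OF z]]
    by (rule real_sqrt_le_mono)
  then have "norm (abs_L2 z) \<le> sqrt (c\<^sup>2)" by (simp only: norm_eq_sqrt_inner)
  then show ?thesis using c0 by simp
qed

lemma abs_L2_diff:
  assumes "continuous_on {0..1} y" "continuous_on {0..1} z"
  shows "abs_L2 y - abs_L2 z = abs_L2 (\<lambda>x. y x - z x)"
proof -
  have "continuous_on {0..1} (\<lambda>x. - z x)" using assms by (intro continuous_intros)
  then show ?thesis
    using assms by (simp add: minus_L2_def uminus_L2.abs_eq plus_L2.abs_eq L2_rel_continuous)
qed

lemma abs_L2_scaleR: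
  "continuous_on {0..1} z \<Longrightarrow> c *\<^sub>R abs_L2 z = abs_L2 (\<lambda>x. c *\<^sub>R z x)"
  by (simp add: scaleR_L2.abs_eq L2_rel_continuous)

lemma rep_abs_L2_AE: "continuous_on {0..1} z \<Longrightarrow> AE x in unit_leb. rep_L2 (abs_L2 z) x = z x"
  using Quotient3_rep_abs[OF Quotient3_L2 L2_rel_continuous, of z] by (simp add: L2_rel_def)

text \<open>
  A continuously differentiable function represents an element of \<open>H\<^sup>1\<close>: the representatives chosen
  by \<open>rep_L2\<close> differ from it on a null set only, which integrals do not see.
\<close>

lemma H1_deriv_C1:
  fixes z :: "real \<Rightarrow> 'a::{real_inner, complete_space}"
  assumes z: "\<And>x. x \<in> {0..1} \<Longrightarrow> (z has_vector_derivative z' x) (at x within {0..1})"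
    and z': "continuous_on {0..1} z'"
  shows "H1_deriv (abs_L2 z) z (abs_L2 z')"
  unfolding H1_deriv_def
proof (intro conjI ballI)
  have "continuous_on {0..1} z"
    using z by (meson continuous_on_eq_continuous_within has_vector_derivative_continuous)
  then show "AE x in unit_leb. rep_L2 (abs_L2 z) x = z x" by (rule rep_abs_L2_AE)
  fix x :: real assume x: "x \<in> {0..1}"
  have int: "(z' has_integral (z x - z 0)) {0..x}"
    by (rule has_integral_vector_derivative)
       (use x in \<open>auto intro!: has_vector_derivative_within_subset[OF z]\<close>)
  have "AE y in lebesgue. y \<in> {0<..<1} \<longrightarrow> rep_L2 (abs_L2 z') y = z' y"
    using rep_abs_L2_AE[OF z'] by (simp add: AE_restrict_space_iff)
  then obtain N where N: "N \<in> null_sets lebesgue"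
      "{y \<in> space lebesgue. \<not> (y \<in> {0<..<1} \<longrightarrow> rep_L2 (abs_L2 z') y = z' y)} \<subseteq> N"
    unfolding eventually_ae_filter by blast
  have "negligible (N \<union> {0, 1})"
    using N(1) by (intro negligible_Un) (auto simp: negligible_iff_null_sets)
  then show "(rep_L2 (abs_L2 z') has_integral (z x - z 0)) {0..x}"
  proof (rule has_integral_spike[OF _ _ int])
    fix y assume y: "y \<in> {0..x} - (N \<union> {0, 1})"
    then have "y \<noteq> 0" "y \<noteq> 1" "0 \<le> y" "y \<le> 1" "y \<notin> N" using x by auto
    then have "y \<in> {0<..<1}" by simp
    then show "rep_L2 (abs_L2 z') y = z' y" using N(2) \<open>y \<notin> N\<close> by auto
  qed
qed

section \<open>The state of the delay system\<close>

text \<open>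
  The second component of the state of the delay system at time \<open>s\<close>.
\<close>

definition history ::
  "('a \<Rightarrow>\<^sub>L 'a) \<Rightarrow> real \<Rightarrow> (real \<Rightarrow> 'a::{real_inner, complete_space}) \<Rightarrow> real \<Rightarrow> 'a L2" where
  "history B \<tau> u s = abs_L2 (\<lambda>\<rho>. blinfun_apply B (u (s - \<tau> * \<rho>)))"

lemma continuous_history_integrand:
  fixes u :: "real \<Rightarrow> 'a::real_normed_vector"
  assumes u: "continuous_on UNIV u"
  shows "continuous_on X (\<lambda>\<rho>. blinfun_apply B (u (s - \<tau> * \<rho>)))"
proof -
  have "continuous_on X (\<lambda>\<rho>. s - \<tau> * \<rho>)" by (intro continuous_intros)
  from continuous_on_compose2[OF u this] show ?thesis by (intro continuous_intros) simp
qed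

lemma norm_history_le:
  assumes u: "continuous_on UNIV u" and \<tau>: "\<tau> > 0" and c: "\<And>r. r \<in> {s - \<tau>..s} \<Longrightarrow> norm (u r) \<le> c"
  shows "norm (history B \<tau> u s) \<le> norm B * c"
  unfolding history_def
proof (rule norm_abs_L2_le[OF continuous_history_integrand[OF u]])
  fix x :: real assume "x \<in> {0<..<1}"
  then have "s - \<tau> * x \<in> {s - \<tau>..s}"
    using \<tau> mult_left_mono[of x 1 \<tau>] by simp
  then show "norm (blinfun_apply B (u (s - \<tau> * x))) \<le> norm B * c"
    by (intro order.trans[OF norm_blinfun] mult_left_mono c) auto
qed

lemma history_diff:
  assumes "continuous_on UNIV u" "continuous_on UNIV v"
  shows "history B \<tau> u s - history B \<tau> v s = history B \<tau> (\<lambda>r. u r - v r) s"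
  using assms by (simp add: history_def abs_L2_diff continuous_history_integrand blinfun.diff_right)

lemma history_scaleR:
  "continuous_on UNIV u \<Longrightarrow> c *\<^sub>R history B \<tau> u s = history B \<tau> (\<lambda>r. c *\<^sub>R u r) s"
  by (simp add: history_def abs_L2_scaleR continuous_history_integrand blinfun.scaleR_right)

lemma history_shift: "history B \<tau> u (s + h) = history B \<tau> (\<lambda>r. u (r + h)) s"
  by (simp add: history_def algebra_simps)

lemma history_difference_quotient:
  assumes u: "\<And>r. (u has_vector_derivative v r) (at r)" and v: "continuous_on UNIV v" and \<tau>: "\<tau> > 0"
  shows "((\<lambda>h. (1 / h) *\<^sub>R (history B \<tau> u (s + h) - history B \<tau> u s)) \<longlongrightarrow> history B \<tau> v s) (at_right 0)"
proof (rule tendstoI)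
  fix e :: real assume e: "e > 0"
  have uc: "continuous_on UNIV u"
    using u by (meson continuous_at_imp_continuous_on has_vector_derivative_continuous)
  have uh: "continuous_on UNIV (\<lambda>r. u (r + h))" for h
    by (intro continuous_on_compose2[OF uc] continuous_intros) simp
  define \<eta> where "\<eta> = e / (norm B + 1)"
  have nB: "norm B + 1 > 0" using norm_ge_zero[of B] by linarith
  have \<eta>: "\<eta> > 0" using e nB by (simp add: \<eta>_def)
  have "eventually (\<lambda>h. \<forall>r\<in>{s - \<tau>..s}. norm ((1 / h) *\<^sub>R (u (r + h) - u r) - v r) \<le> \<eta>) (at_right 0)"
    by (rule difference_quotient_uniform[OF u v \<eta>])
  then show "eventually (\<lambda>h. dist ((1 / h) *\<^sub>R (history B \<tau> u (s + h) - history B \<tau> u s)) (history B \<tau> v s) < e)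
      (at_right 0)"
  proof eventually_elim
    case (elim h)
    have c1: "continuous_on UNIV (\<lambda>r. u (r + h) - u r)" by (intro continuous_intros uh uc)
    have c2: "continuous_on UNIV (\<lambda>r. (1 / h) *\<^sub>R (u (r + h) - u r))" by (intro continuous_intros uh uc)
    have c3: "continuous_on UNIV (\<lambda>r. (1 / h) *\<^sub>R (u (r + h) - u r) - v r)" by (intro continuous_intros uh uc v)
    have "norm (history B \<tau> (\<lambda>r. (1 / h) *\<^sub>R (u (r + h) - u r) - v r) s) \<le> norm B * \<eta>"
      using elim by (intro norm_history_le c3 \<tau>) auto
    also have "\<dots> < e" using e nB by (simp add: \<eta>_def field_simps)
    finally show ?case
      by (simp only: dist_norm history_shift history_diff[OF uh uc] history_scaleR[OF c1] history_diff[OF c2 v])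
  qed
qed

lemma continuous_history:
  assumes u: "continuous_on UNIV u" and \<tau>: "\<tau> > 0"
  shows "continuous_on {a..b} (history B \<tau> u)"
  unfolding continuous_on_iff
proof (intro ballI allI impI)
  fix s e :: real assume s: "s \<in> {a..b}" and e: "e > 0"
  define \<eta> where "\<eta> = e / (norm B + 1)"
  have nB: "norm B + 1 > 0" using norm_ge_zero[of B] by linarith
  have \<eta>: "\<eta> > 0" using e nB by (simp add: \<eta>_def)
  have "uniformly_continuous_on {a - \<tau>..b} u"
    by (intro compact_uniformly_continuous continuous_on_subset[OF u]) auto
  then obtain d where d: "d > 0"
      "\<And>r r'. r \<in> {a - \<tau>..b} \<Longrightarrow> r' \<in> {a - \<tau>..b} \<Longrightarrow> dist r r' < d \<Longrightarrow> dist (u r) (u r') < \<eta>"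
    using \<eta> unfolding uniformly_continuous_on_def by metis
  show "\<exists>d>0. \<forall>s'\<in>{a..b}. dist s' s < d \<longrightarrow> dist (history B \<tau> u s') (history B \<tau> u s) < e"
  proof (intro exI[of _ d] conjI ballI impI d(1))
    fix s' assume s': "s' \<in> {a..b}" "dist s' s < d"
    have us: "continuous_on UNIV (\<lambda>r. u (r + (s' - s)))"
      by (intro continuous_on_compose2[OF u] continuous_intros) simp
    have "norm (history B \<tau> (\<lambda>r. u (r + (s' - s)) - u r) s) \<le> norm B * \<eta>"
    proof (rule norm_history_le[OF _ \<tau>])
      show "continuous_on UNIV (\<lambda>r. u (r + (s' - s)) - u r)" by (intro continuous_intros us u)
      fix r assume "r \<in> {s - \<tau>..s}"
      then show "norm (u (r + (s' - s)) - u r) \<le> \<eta>"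
        using d(2)[of "r + (s' - s)" r] s s' by (auto simp: dist_norm less_imp_le)
    qed
    also have "\<dots> < e" using e nB by (simp add: \<eta>_def field_simps)
    finally show "dist (history B \<tau> u s') (history B \<tau> u s) < e"
      using history_shift[of B \<tau> u s "s' - s"] by (simp add: dist_norm history_diff[OF us u])
  qed
qed

text \<open>
  The minus sign and the factor \<open>\<tau>\<close> of the transport equation cancel against the chain rule for
  \<open>\<rho> \<mapsto> s - \<tau> * \<rho>\<close>, so the second component of the image is the history of the derivative.
  The boundary condition at \<open>\<rho> = 0\<close> holds by construction, and the trace at \<open>\<rho> = 1\<close> is
  the delayed value.
\<close>

lemma state_in_delay_operator:
  assumes u: "\<And>r. (u has_vector_derivative v r) (at r)" and v: "continuous_on UNIV v" and \<tau>: "\<tau> > 0"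
    and A: "(u s, a) \<in> A"
  shows "((u s, history B \<tau> u s), (a + k *\<^sub>R blinfun_apply B (u (s - \<tau>)), history B \<tau> v s))
           \<in> delay_operator A B \<tau> k"
proof -
  define z where "z \<rho> = blinfun_apply B (u (s - \<tau> * \<rho>))" for \<rho>
  define z' where "z' \<rho> = (- \<tau>) *\<^sub>R blinfun_apply B (v (s - \<tau> * \<rho>))" for \<rho>
  have z'c: "continuous_on {0..1} z'"
    unfolding z'_def by (intro continuous_intros continuous_history_integrand v)
  have "H1_deriv (abs_L2 z) z (abs_L2 z')"
  proof (rule H1_deriv_C1[OF _ z'c])
    fix x :: real
    have 1: "((\<lambda>\<rho>. s - \<tau> * \<rho>) has_vector_derivative - \<tau>) (at x within {0..1})"
      by (auto intro!: derivative_eq_intros)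
    have "((\<lambda>\<rho>. u (s - \<tau> * \<rho>)) has_vector_derivative (- \<tau>) *\<^sub>R v (s - \<tau> * x)) (at x within {0..1})"
      using vector_diff_chain_within[OF 1 has_vector_derivative_at_within[OF u]] by (simp add: o_def)
    from bounded_linear.has_vector_derivative[OF blinfun.bounded_linear_right this]
    show "(z has_vector_derivative z' x) (at x within {0..1})"
      by (simp add: z_def[abs_def] z'_def blinfun.scaleR_right blinfun.minus_right)
  qed
  moreover have "history B \<tau> v s = - (1 / \<tau>) *\<^sub>R abs_L2 z'"
    using \<tau> by (simp only: abs_L2_scaleR[OF z'c]) (simp add: history_def z'_def)
  moreover have "z 0 = blinfun_apply B (u s)" "z 1 = blinfun_apply B (u (s - \<tau>))"
    by (simp_all add: z_def)
  ultimately show ?thesis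
    using A unfolding delay_operator_def history_def[of B \<tau> u] z_def[abs_def, symmetric]
    by (intro CollectI exI[of _ "u s"] exI[of _ "abs_L2 z"] exI[of _ a] exI[of _ z] exI[of _ "abs_L2 z'"])
       simp
qed

text \<open>
  The link between the mild formulation, which knows only \<open>S\<close>, and the delay semigroup \<open>T\<close>.  The
  state built from the average of \<open>u\<close> lies in the domain of the delay operator and satisfies the
  abstract equation with right-hand side \<open>(average \<epsilon> G s, 0)\<close>.  Hence the Duhamel inequality
  applies to it, and letting \<open>\<epsilon>\<close> tend to 0 gives the estimate for \<open>u\<close> itself.  Starting at
  time \<open>\<tau>\<close> guarantees that the history consists of values of \<open>u\<close> at nonnegative times.
\<close>

lemma delay_duhamel_bound:
  fixes S :: "real \<Rightarrow> 'a::{real_inner, complete_space} \<Rightarrow>\<^sub>L 'a"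
  assumes S: "C0_semigroup S" and boundS: "\<And>t. t \<ge> 0 \<Longrightarrow> norm (S t) \<le> K"
    and T: "C0_semigroup T" and genT: "generator T = delay_operator (generator S) B \<tau> k"
    and boundT: "\<And>t. t > 0 \<Longrightarrow> norm (T t) \<le> N * exp (- w * t)"
    and N: "N \<ge> 0" and w: "w \<ge> 0" and \<tau>: "\<tau> > 0"
    and u: "continuous_on UNIV u" and G: "continuous_on UNIV G"
    and mild: "\<And>s h. s \<ge> \<tau> \<Longrightarrow> h \<ge> 0 \<Longrightarrow> u (s + h) = blinfun_apply (S h) (u s)
       + integral {s..s + h} (\<lambda>r. blinfun_apply (S (s + h - r)) (G r + k *\<^sub>R blinfun_apply B (u (r - \<tau>))))"
    and c: "\<And>r. r \<in> {0..\<tau>} \<Longrightarrow> norm (u r) \<le> c" and t: "t > \<tau>"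
  shows "norm (u t) \<le> N * exp (- w * (t - \<tau>)) * ((1 + norm B) * c)
           + integral {\<tau>..t} (\<lambda>s. N * exp (- w * (t - s)) * norm (G s))"
    (is "_ \<le> ?E * (_ * c) + ?J")
proof (rule field_le_epsilon)
  fix e :: real assume e: "e > 0"
  \<comment> \<open>\<open>Q\<close> collects the coefficients of the regularisation error \<open>\<delta>\<close>: in \<open>u t\<close>, in the
     initial state and in the source.\<close>
  define Q where "Q = 1 + ?E * (1 + norm B) + N * (t - \<tau>)"
  have Q: "Q > 0" using N t by (simp add: Q_def add_pos_nonneg)
  define \<delta> where "\<delta> = e / Q"
  have \<delta>: "\<delta> > 0" using e Q by (simp add: \<delta>_def)
  obtain d1 where d1: "d1 > 0"
      "\<And>\<epsilon> s. 0 < \<epsilon> \<Longrightarrow> \<epsilon> < d1 \<Longrightarrow> s \<in> {0..t} \<Longrightarrow> norm (average \<epsilon> u s - u s) \<le> \<delta>"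
    using average_uniformly_close[OF u \<delta>] by blast
  obtain d2 where d2: "d2 > 0"
      "\<And>\<epsilon> s. 0 < \<epsilon> \<Longrightarrow> \<epsilon> < d2 \<Longrightarrow> s \<in> {0..t} \<Longrightarrow> norm (average \<epsilon> G s - G s) \<le> \<delta>"
    using average_uniformly_close[OF G \<delta>] by blast
  define \<epsilon> where "\<epsilon> = min d1 d2 / 2"
  have \<epsilon>: "0 < \<epsilon>" "\<epsilon> < d1" "\<epsilon> < d2" using d1(1) d2(1) by (auto simp: \<epsilon>_def)
  define U where "U = average \<epsilon> u"
  define V where "V s = (1 / \<epsilon>) *\<^sub>R (u (s + \<epsilon>) - u s)" for s
  define g where "g r = G r + k *\<^sub>R blinfun_apply B (u (r - \<tau>))" for r
  define a where "a s = V s - average \<epsilon> g s" for s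
  define W where "W s = (U s, history B \<tau> U s)" for s
  define y where "y s = (a s + k *\<^sub>R blinfun_apply B (U (s - \<tau>)), history B \<tau> V s)" for s
  define q :: "real \<Rightarrow> 'a \<times> 'a L2" where "q s = (average \<epsilon> G s, 0)" for s
  have ud: "continuous_on UNIV (\<lambda>r. u (r - \<tau>))"
    by (intro continuous_on_compose2[OF u] continuous_intros) simp
  have g: "continuous_on UNIV g"
    unfolding g_def by (intro continuous_intros G ud)
  have V: "continuous_on UNIV V"
    unfolding V_def by (intro continuous_intros continuous_on_compose2[OF u] u) auto
  have UV: "(U has_vector_derivative V s) (at s)" for s
    unfolding U_def V_def by (rule average_has_vector_derivative[OF u \<epsilon>(1)])
  have U: "continuous_on X U" for X
    unfolding U_def by (rule continuous_average[OF u \<epsilon>(1)])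
  have int: "f integrable_on {x..z}" if "continuous_on UNIV f" for f :: "real \<Rightarrow> 'a" and x z
    by (intro continuous_integrable continuous_on_subset[OF that]) simp
  have avg_g: "average \<epsilon> g s = average \<epsilon> G s + k *\<^sub>R blinfun_apply B (U (s - \<tau>))" for s
  proof -
    have L: "bounded_linear (\<lambda>x. k *\<^sub>R blinfun_apply B x)"
      by (intro bounded_linear_intros)
    have "average \<epsilon> (\<lambda>r. k *\<^sub>R blinfun_apply B (u (r - \<tau>))) s = k *\<^sub>R blinfun_apply B (U (s - \<tau>))"
      using average_shift[of \<epsilon> u "- \<tau>" s] by (simp add: average_bounded_linear[OF L int[OF ud]] U_def)
    moreover have "continuous_on UNIV (\<lambda>r. k *\<^sub>R blinfun_apply B (u (r - \<tau>)))"
      by (intro continuous_intros ud)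
    ultimately show ?thesis
      unfolding g_def[abs_def] by (simp add: average_add int G)
  qed
  have close: "norm (U s) \<le> norm (u s) + \<delta>" "norm (u s) \<le> norm (U s) + \<delta>" if "s \<in> {0..t}" for s
    using d1(2)[OF \<epsilon>(1,2) that] norm_triangle_ineq2[of "U s" "u s"] norm_triangle_ineq3[of "U s" "u s"]
    by (auto simp: U_def)
  have "norm (W t) \<le> N * exp (- w * (t - \<tau>)) * norm (W \<tau>)
           + integral {\<tau>..t} (\<lambda>s. N * exp (- w * (t - s)) * (norm (G s) + \<delta>))"
  proof (rule semigroup_duhamel_bound[OF T boundT w t, where y = y and q = q])
    show "continuous_on {\<tau>..t} W"
      unfolding W_def by (intro continuous_on_Pair U continuous_history \<tau>)
    show "continuous_on {\<tau>..t} (\<lambda>s. norm (G s) + \<delta>)"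
      by (intro continuous_intros continuous_on_subset[OF G]) simp
    fix s assume s: "s \<in> {\<tau>..<t}"
    have "(U s, a s) \<in> generator S"
      unfolding U_def a_def V_def using s mild
      by (intro average_in_generator[OF S boundS u g \<epsilon>(1)]) (auto simp: g_def)
    then show "(W s, y s) \<in> generator T"
      unfolding genT W_def y_def by (rule state_in_delay_operator[OF UV V \<tau>])
    have "((\<lambda>h. ((1 / h) *\<^sub>R (U (s + h) - U s), (1 / h) *\<^sub>R (history B \<tau> U (s + h) - history B \<tau> U s)))
        \<longlongrightarrow> (V s, history B \<tau> V s)) (at_right 0)"
      by (intro tendsto_Pair difference_quotient_tendsto[OF UV V] history_difference_quotient[OF UV V \<tau>])
    moreover have "(V s, history B \<tau> V s) = y s + q s"
      by (simp add: y_def q_def a_def avg_g)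
    ultimately show "((\<lambda>h. (1 / h) *\<^sub>R (W (s + h) - W s)) \<longlongrightarrow> y s + q s) (at_right 0)"
      by (simp add: W_def)
    show "norm (q s) \<le> norm (G s) + \<delta>"
      using d2(2)[OF \<epsilon>(1,3), of s] s \<tau> norm_triangle_ineq2[of "average \<epsilon> G s" "G s"]
      by (auto simp: q_def norm_Pair)
  qed
  also have "N * exp (- w * (t - \<tau>)) * norm (W \<tau>) \<le> ?E * ((1 + norm B) * (c + \<delta>))"
  proof (intro mult_left_mono)
    have Uc: "norm (U r) \<le> c + \<delta>" if "r \<in> {0..\<tau>}" for r
      using close(1)[of r] c[OF that] that t by auto
    have "norm (W \<tau>) \<le> norm (U \<tau>) + norm (history B \<tau> U \<tau>)"
      unfolding W_def by (rule norm_Pair_le)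
    also have "\<dots> \<le> (c + \<delta>) + norm B * (c + \<delta>)"
      using \<tau> by (intro add_mono Uc norm_history_le U) auto
    finally show "norm (W \<tau>) \<le> (1 + norm B) * (c + \<delta>)" by (simp add: algebra_simps)
  qed (use N in simp)
  also have "integral {\<tau>..t} (\<lambda>s. N * exp (- w * (t - s)) * (norm (G s) + \<delta>)) \<le> ?J + \<delta> * (N * (t - \<tau>))"
  proof -
    have c1: "(\<lambda>s. N * exp (- w * (t - s)) * norm (G s)) integrable_on {\<tau>..t}"
      by (intro integrable_continuous_real continuous_intros continuous_on_subset[OF G]) simp
    have c2: "(\<lambda>s. N * exp (- w * (t - s)) * norm (G s) + \<delta> * N) integrable_on {\<tau>..t}"
      by (intro integrable_continuous_real continuous_intros continuous_on_subset[OF G]) simp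
    have "integral {\<tau>..t} (\<lambda>s. N * exp (- w * (t - s)) * (norm (G s) + \<delta>))
        \<le> integral {\<tau>..t} (\<lambda>s. N * exp (- w * (t - s)) * norm (G s) + \<delta> * N)"
    proof (rule integral_le[OF _ c2])
      show "(\<lambda>s. N * exp (- w * (t - s)) * (norm (G s) + \<delta>)) integrable_on {\<tau>..t}"
        by (intro integrable_continuous_real continuous_intros continuous_on_subset[OF G]) simp
      fix s assume "s \<in> {\<tau>..t}"
      then have "exp (- w * (t - s)) * (N * \<delta>) \<le> 1 * (N * \<delta>)"
        using w N \<delta> by (intro mult_right_mono) auto
      then show "N * exp (- w * (t - s)) * (norm (G s) + \<delta>) \<le> N * exp (- w * (t - s)) * norm (G s) + \<delta> * N"
        by (simp add: algebra_simps)
    qed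
    also have "\<dots> = ?J + \<delta> * (N * (t - \<tau>))"
      using t by (subst integral_add[OF c1]) auto
    finally show ?thesis .
  qed
  finally have "norm (W t) \<le> ?E * ((1 + norm B) * (c + \<delta>)) + (?J + \<delta> * (N * (t - \<tau>)))" by simp
  moreover have "norm (u t) \<le> norm (W t) + \<delta>"
    using close(2)[of t] norm_fst_le[of "U t" "history B \<tau> U t"] \<tau> t by (simp add: W_def)
  moreover have "\<delta> * Q = e" using Q by (simp add: \<delta>_def)
  then have "e = \<delta> + \<delta> * (?E * (1 + norm B)) + \<delta> * (N * (t - \<tau>))"
    by (simp only: Q_def distrib_left mult_1_right)
  ultimately show "norm (u t) \<le> ?E * ((1 + norm B) * c) + ?J + e"
    by (simp add: algebra_simps)
qed

section \<open>The thresholds\<close>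

lemma omega_prime_pos:
  assumes "M > 0" "\<tau> > 0" "\<omega> > 0" and k: "ereal \<bar>k\<bar> < k_zero M \<omega> B \<tau>"
  shows "omega_prime M \<omega> B \<tau> k > 0"
proof (cases "B = 0")
  case True
  then show ?thesis using assms by (simp add: omega_prime_def)
next
  case False
  define D where "D = \<tau> * norm B * M * exp (\<omega> * \<tau>)"
  have D: "D > 0" using False assms by (simp add: D_def)
  have "\<bar>k\<bar> < (exp (\<omega> * \<tau>) - 1) / D"
    using k False by (simp add: k_zero_def D_def mult.commute)
  then have "1 + \<bar>k\<bar> * D < exp (\<omega> * \<tau>)"
    using D by (simp add: field_simps)
  moreover have "1 + \<bar>k\<bar> * D > 0" using D by (intro add_pos_nonneg) auto
  ultimately have "ln (1 + \<bar>k\<bar> * D) < \<omega> * \<tau>"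
    using ln_less_cancel_iff[of "1 + \<bar>k\<bar> * D" "exp (\<omega> * \<tau>)"] by simp
  then have "(1 / \<tau>) * ln (1 + \<bar>k\<bar> * D) < \<omega>"
    using \<open>\<tau> > 0\<close> by (simp add: divide_less_eq)
  then show ?thesis by (simp add: omega_prime_def D_def mult.assoc)
qed

text \<open>
  If \<open>chi\<close> reaches \<open>y\<close> at all, it takes the value \<open>y\<close> by the intermediate value theorem, so the
  inverse is a genuine preimage.
\<close>

lemma less_extended_inverse:
  assumes chi: "continuous_on {0..} chi" "strict_mono_on {0..} chi" "chi 0 = 0"
    and y: "y > 0" and c: "c \<ge> 0" "ereal c < extended_inverse chi y"
  shows "chi c < y"
proof (cases "\<forall>x\<ge>0. chi x < y")
  case True
  then show ?thesis using c by simp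
next
  case False
  then obtain x where x: "x \<ge> 0" "y \<le> chi x" by (auto simp: not_less)
  have "continuous_on {0..x} chi" by (rule continuous_on_subset[OF chi(1)]) auto
  then obtain x0 where x0: "0 \<le> x0" "chi x0 = y"
    using IVT'[of chi 0 y x] x y chi(3) by auto
  have "the_inv_into {0..} chi y = x0"
    using the_inv_into_f_f[OF strict_mono_on_imp_inj_on[OF chi(2)], of x0] x0 by simp
  then have "c < x0" using c(2) False by (auto simp: extended_inverse_def)
  then show ?thesis using strict_mono_onD[OF chi(2), of c x0] c(1) x0 by simp
qed

lemma continuous_if_locally_lipschitz:
  fixes F :: "'a::real_normed_vector \<Rightarrow> 'b::real_normed_vector"
  assumes lip: "\<And>c. c > 0 \<Longrightarrow> \<exists>L>0. \<forall>u v. norm u \<le> c \<and> norm v \<le> c \<longrightarrow>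
         norm (F u - F v) \<le> L * norm (u - v)"
  shows "continuous_on UNIV F"
proof -
  have "isCont F x" for x
  proof -
    obtain L where L: "L > 0" "\<And>u v. norm u \<le> norm x + 1 \<Longrightarrow> norm v \<le> norm x + 1 \<Longrightarrow>
        norm (F u - F v) \<le> L * norm (u - v)"
      using lip[of "norm x + 1"] by (auto simp: add_nonneg_pos)
    have "continuous_on (ball x 1) F"
      unfolding continuous_on_iff
    proof (intro ballI allI impI)
      fix v e :: "_" assume v: "v \<in> ball x 1" and e: "(e::real) > 0"
      have le: "norm u \<le> norm x + 1" if "u \<in> ball x 1" for u
        using that norm_triangle_ineq2[of u x] by (simp add: dist_norm norm_minus_commute)
      show "\<exists>d>0. \<forall>u\<in>ball x 1. dist u v < d \<longrightarrow> dist (F u) (F v) < e"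
      proof (intro exI[of _ "e / L"] conjI ballI impI)
        fix u assume u: "u \<in> ball x 1" "dist u v < e / L"
        have "dist (F u) (F v) \<le> L * dist u v" using L(2)[OF le[OF u(1)] le[OF v]] by (simp add: dist_norm)
        also have "\<dots> < e" using u(2) L(1) by (simp add: field_simps)
        finally show "dist (F u) (F v) < e" .
      qed (use e L in simp)
    qed
    then show ?thesis by (simp add: continuous_on_eq_continuous_at)
  qed
  then show ?thesis by (simp add: continuous_on_eq_continuous_at)
qed

section \<open>Bounds for mild solutions\<close>

definition forcing ::
  "('a \<Rightarrow> 'a) \<Rightarrow> ('a \<Rightarrow>\<^sub>L 'a) \<Rightarrow> real \<Rightarrow> real \<Rightarrow> (real \<Rightarrow> 'a) \<Rightarrow> (real \<Rightarrow> 'a) \<Rightarrow> real \<Rightarrow>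
    'a::real_normed_vector" where
  "forcing F B \<tau> k f U s = F (U s) + k *\<^sub>R (if s < \<tau> then f s else blinfun_apply B (U (s - \<tau>)))"

text \<open>
  Before the delay has elapsed the forcing is given by \<open>f\<close>, except at the single time \<open>\<tau>\<close>, where it
  already takes the value produced by the solution.
\<close>

lemma early_forcing:
  fixes S :: "real \<Rightarrow> 'a::{real_normed_vector, complete_space} \<Rightarrow>\<^sub>L 'a"
  assumes S: "C0_semigroup S" and boundS: "\<And>t. t \<ge> 0 \<Longrightarrow> norm (S t) \<le> M"
    and F: "continuous_on UNIV F" and f: "continuous_on {0..\<tau>} f" and U: "continuous_on {0..} U"
    and t: "t \<ge> b" "b \<le> \<tau>"
  shows "(\<lambda>r. blinfun_apply (S (t - r)) (F (U r) + k *\<^sub>R f r)) integrable_on {0..b}"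
    and "(\<lambda>r. blinfun_apply (S (t - r)) (forcing F B \<tau> k f U r)) integrable_on {0..b}"
    and "integral {0..b} (\<lambda>r. blinfun_apply (S (t - r)) (forcing F B \<tau> k f U r))
       = integral {0..b} (\<lambda>r. blinfun_apply (S (t - r)) (F (U r) + k *\<^sub>R f r))"
proof -
  have "continuous_on {0..b} (\<lambda>r. F (U r))"
    by (rule continuous_on_compose2[OF F continuous_on_subset[OF U]]) auto
  then have "continuous_on {0..b} (\<lambda>r. blinfun_apply (S (t - r)) (F (U r) + k *\<^sub>R f r))"
    using t by (intro C0_semigroup_continuous_joint[OF S boundS] continuous_intros
        continuous_on_subset[OF f]) auto
  then show 1: "(\<lambda>r. blinfun_apply (S (t - r)) (F (U r) + k *\<^sub>R f r)) integrable_on {0..b}"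
    by (rule continuous_integrable)
  have eq: "blinfun_apply (S (t - r)) (forcing F B \<tau> k f U r) = blinfun_apply (S (t - r)) (F (U r) + k *\<^sub>R f r)"
    if "r \<in> {0..b} - {\<tau>}" for r
    using that t by (simp add: forcing_def)
  show "(\<lambda>r. blinfun_apply (S (t - r)) (forcing F B \<tau> k f U r)) integrable_on {0..b}"
    by (rule integrable_spike_finite[OF _ eq 1, of "{\<tau>}"]) auto
  show "integral {0..b} (\<lambda>r. blinfun_apply (S (t - r)) (forcing F B \<tau> k f U r))
       = integral {0..b} (\<lambda>r. blinfun_apply (S (t - r)) (F (U r) + k *\<^sub>R f r))"
    by (rule integral_spike[of "{\<tau>}"]) (use eq in auto)
qed

lemma forcing_integrable:
  fixes S :: "real \<Rightarrow> 'a::{real_normed_vector, complete_space} \<Rightarrow>\<^sub>L 'a"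
  assumes S: "C0_semigroup S" and boundS: "\<And>t. t \<ge> 0 \<Longrightarrow> norm (S t) \<le> M"
    and F: "continuous_on UNIV F" and f: "continuous_on {0..\<tau>} f" and U: "continuous_on {0..} U"
    and \<tau>: "\<tau> > 0" and t: "t \<ge> 0"
  shows "(\<lambda>r. blinfun_apply (S (t - r)) (forcing F B \<tau> k f U r)) integrable_on {0..t}"
proof (cases "t \<le> \<tau>")
  case True
  then show ?thesis by (intro early_forcing[OF S boundS F f U]) auto
next
  case False
  have Fc: "continuous_on {\<tau>..t} (\<lambda>r. F (U r))"
    by (rule continuous_on_compose2[OF F continuous_on_subset[OF U]]) (use \<tau> in auto)
  have Ud: "continuous_on {\<tau>..t} (\<lambda>r. U (r - \<tau>))"
    by (rule continuous_on_compose2[OF U]) (auto intro!: continuous_intros)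
  have "continuous_on {\<tau>..t} (\<lambda>r. blinfun_apply (S (t - r)) (F (U r) + k *\<^sub>R blinfun_apply B (U (r - \<tau>))))"
    by (intro C0_semigroup_continuous_joint[OF S boundS] continuous_intros Fc Ud) auto
  then have "(\<lambda>r. blinfun_apply (S (t - r)) (F (U r) + k *\<^sub>R blinfun_apply B (U (r - \<tau>)))) integrable_on {\<tau>..t}"
    by (rule continuous_integrable)
  then have 2: "(\<lambda>r. blinfun_apply (S (t - r)) (forcing F B \<tau> k f U r)) integrable_on {\<tau>..t}"
    by (rule integrable_eq) (simp add: forcing_def)
  show ?thesis
    by (rule integrable_join[OF _ _ early_forcing(2)[OF S boundS F f U] 2]) (use False \<tau> in auto)
qed

text \<open>
  On the first delay interval the delayed term is known data, so the bound on \<open>S\<close> and Gronwall's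
  inequality suffice.  The data enter through the \<open>L\<^sup>1\<close> norm of \<open>f\<close>.
\<close>

lemma bound_up_to_delay:
  fixes S :: "real \<Rightarrow> 'a::{real_inner, complete_space} \<Rightarrow>\<^sub>L 'a"
  assumes S: "C0_semigroup S" and boundS: "\<And>t. t \<ge> 0 \<Longrightarrow> norm (S t) \<le> M"
    and F: "continuous_on UNIV F" and f: "continuous_on {0..\<tau>} f"
    and mild: "mild_solution S F B \<tau> k U0 f U"
    and q: "q \<ge> 0" "\<And>s. s \<ge> 0 \<Longrightarrow> norm (F (U s)) \<le> q * norm (U s)" and t: "t \<in> {0..\<tau>}"
  shows "norm (U t) \<le> M * (norm U0 + \<bar>k\<bar> * integral {0..\<tau>} (\<lambda>s. norm (f s))) * exp (M * q * t)"
proof -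
  define A where "A = M * (norm U0 + \<bar>k\<bar> * integral {0..\<tau>} (\<lambda>s. norm (f s)))"
  have M: "M \<ge> 0" using order.trans[OF norm_ge_zero boundS[of 0]] by simp
  have U: "continuous_on {0..} U" using mild by (simp add: mild_solution_def)
  have yc: "continuous_on {0..b} (\<lambda>s. norm (U s))" for b
    by (intro continuous_intros continuous_on_subset[OF U]) auto
  have fi: "(\<lambda>s. norm (f s)) integrable_on {0..b}" if "b \<le> \<tau>" for b
    by (intro integrable_continuous_real continuous_intros continuous_on_subset[OF f]) (use that in auto)
  have "norm (U t) \<le> A * exp (M * q * (t - 0))"
  proof (rule gronwall[OF yc _ _ t])
    show "M * q \<ge> 0" using M q by simp
    fix t assume t: "t \<in> {0..\<tau>}"
    let ?Y = "integral {0..t} (\<lambda>s. norm (U s))"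
    have yi: "(\<lambda>s. norm (U s)) integrable_on {0..t}" by (rule integrable_continuous_real[OF yc])
    have fit: "(\<lambda>s. norm (f s)) integrable_on {0..t}" using t by (intro fi) simp
    have i1: "(\<lambda>s. M * q * norm (U s)) integrable_on {0..t}" and i2: "(\<lambda>s. M * \<bar>k\<bar> * norm (f s)) integrable_on {0..t}"
      using yi fit by (auto intro!: integrable_on_mult_right)
    define J where "J = integral {0..t} (\<lambda>r. blinfun_apply (S (t - r)) (F (U r) + k *\<^sub>R f r))"
    have "norm J \<le> integral {0..t} (\<lambda>r. M * q * norm (U r) + M * \<bar>k\<bar> * norm (f r))"
      unfolding J_def
    proof (rule norm_integral_le[OF early_forcing(1)[OF S boundS F f U] integrable_add[OF i1 i2]])
      fix r assume r: "r \<in> {0..t}"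
      have "norm (F (U r) + k *\<^sub>R f r) \<le> q * norm (U r) + \<bar>k\<bar> * norm (f r)"
        using norm_triangle_ineq[of "F (U r)" "k *\<^sub>R f r"] q(2)[of r] r by auto
      then have "norm (blinfun_apply (S (t - r)) (F (U r) + k *\<^sub>R f r)) \<le> M * (q * norm (U r) + \<bar>k\<bar> * norm (f r))"
        using r M by (intro order.trans[OF norm_blinfun] mult_mono boundS) auto
      then show "norm (blinfun_apply (S (t - r)) (F (U r) + k *\<^sub>R f r)) \<le> M * q * norm (U r) + M * \<bar>k\<bar> * norm (f r)"
        by (simp add: algebra_simps)
    qed (use t in auto)
    also have "\<dots> = M * q * ?Y + M * \<bar>k\<bar> * integral {0..t} (\<lambda>s. norm (f s))"
      by (simp add: integral_add[OF i1 i2])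
    also have "integral {0..t} (\<lambda>s. norm (f s)) \<le> integral {0..\<tau>} (\<lambda>s. norm (f s))"
      using t by (intro integral_subset_le fi fit) auto
    finally have "norm J \<le> M * q * ?Y + M * \<bar>k\<bar> * integral {0..\<tau>} (\<lambda>s. norm (f s))"
      using M by (simp add: mult_left_mono)
    moreover have "U t = blinfun_apply (S t) U0 + J"
      using mild t early_forcing(3)[OF S boundS F f U, where t = t and b = t and k = k and B = B]
      by (simp add: mild_solution_def forcing_def[abs_def] J_def)
    moreover have "norm (blinfun_apply (S t) U0) \<le> M * norm U0"
      using t by (intro order.trans[OF norm_blinfun] mult_right_mono boundS) auto
    ultimately show "norm (U t) \<le> A + M * q * ?Y"
      using norm_triangle_ineq[of "blinfun_apply (S t) U0" J] by (simp add: A_def algebra_simps)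
  qed
  then show ?thesis by (simp add: A_def)
qed

text \<open>
  Along the solution the nonlinearity is dominated by \<open>q * norm (U s)\<close>.  Multiplying the Duhamel
  estimate by \<open>exp (w * (s - \<tau>))\<close> turns it into a Gronwall inequality with rate \<open>N * q\<close>; the
  solution decays as soon as this rate is below \<open>w\<close>.
\<close>

lemma decay_beyond_delay:
  fixes S :: "real \<Rightarrow> 'a::{real_inner, complete_space} \<Rightarrow>\<^sub>L 'a"
  assumes S: "C0_semigroup S" and boundS: "\<And>t. t \<ge> 0 \<Longrightarrow> norm (S t) \<le> M"
    and T: "C0_semigroup T" and genT: "generator T = delay_operator (generator S) B \<tau> k"
    and boundT: "\<And>t. t > 0 \<Longrightarrow> norm (T t) \<le> N * exp (- w * t)"
    and N: "N \<ge> 0" and w: "w \<ge> 0" and \<tau>: "\<tau> > 0"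
    and F: "continuous_on UNIV F" and f: "continuous_on {0..\<tau>} f"
    and mild: "mild_solution S F B \<tau> k U0 f U"
    and q: "q \<ge> 0" "\<And>s. s \<ge> 0 \<Longrightarrow> norm (F (U s)) \<le> q * norm (U s)"
    and c: "\<And>r. r \<in> {0..\<tau>} \<Longrightarrow> norm (U r) \<le> c" and t: "t \<ge> \<tau>"
  shows "norm (U t) \<le> (1 + N * (1 + norm B)) * c * exp (- (w - N * q) * (t - \<tau>))"
proof -
  have U: "continuous_on {0..} U" using mild by (simp add: mild_solution_def)
  have c0: "c \<ge> 0" using order.trans[OF norm_ge_zero c[of 0]] \<tau> by simp
  \<comment> \<open>A continuous extension to negative times, so that averages can be taken anywhere.\<close>
  define u where "u s = U (max 0 s)" for s
  have u: "continuous_on UNIV u"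
    unfolding u_def by (rule continuous_on_compose2[OF U]) (auto intro!: continuous_intros)
  have uU: "u s = U s" if "s \<ge> 0" for s using that by (simp add: u_def max_def)
  have Fu: "continuous_on UNIV (\<lambda>s. F (u s))" by (rule continuous_on_compose2[OF F u]) simp
  have step: "u (s + h) = blinfun_apply (S h) (u s) + integral {s..s + h}
      (\<lambda>r. blinfun_apply (S (s + h - r)) (F (u r) + k *\<^sub>R blinfun_apply B (u (r - \<tau>))))"
    if s: "s \<ge> \<tau>" and h: "h \<ge> 0" for s h
  proof -
    have "U (s + h) = blinfun_apply (S h) (U s) + integral {s..s + h}
        (\<lambda>r. blinfun_apply (S (s + h - r)) (forcing F B \<tau> k f U r))"
    proof (rule mild_formula_step[OF S forcing_integrable[OF S boundS F f U \<tau>]])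
      show "U t = blinfun_apply (S t) U0 + integral {0..t} (\<lambda>r. blinfun_apply (S (t - r)) (forcing F B \<tau> k f U r))"
        if "t \<ge> 0" for t
        using mild that by (simp add: mild_solution_def forcing_def)
    qed (use s h \<tau> in auto)
    also have "integral {s..s + h} (\<lambda>r. blinfun_apply (S (s + h - r)) (forcing F B \<tau> k f U r))
      = integral {s..s + h} (\<lambda>r. blinfun_apply (S (s + h - r)) (F (u r) + k *\<^sub>R blinfun_apply B (u (r - \<tau>))))"
      using s \<tau> by (intro integral_cong) (simp add: forcing_def uU)
    finally show ?thesis using s h \<tau> by (simp add: uU)
  qed
  define \<phi> where "\<phi> s = exp (w * (s - \<tau>)) * norm (u s)" for s
  define A where "A = (1 + N * (1 + norm B)) * c"
  have \<phi>: "continuous_on {\<tau>..t} \<phi>"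
    unfolding \<phi>_def by (intro continuous_intros continuous_on_subset[OF u]) simp
  have "\<phi> t \<le> A * exp (N * q * (t - \<tau>))"
  proof (rule gronwall[OF \<phi>])
    show "N * q \<ge> 0" using N q by simp
    fix r assume r: "r \<in> {\<tau>..t}"
    show "\<phi> r \<le> A + N * q * integral {\<tau>..r} \<phi>"
    proof (cases "r = \<tau>")
      case True
      have "norm (u \<tau>) \<le> 1 * c" using c[of \<tau>] \<tau> by (simp add: uU)
      also have "\<dots> \<le> A" unfolding A_def using N c0 by (intro mult_right_mono) auto
      finally show ?thesis using True by (simp add: \<phi>_def)
    next
      case False
      have \<phi>r: "\<phi> integrable_on {\<tau>..r}"
        using r by (intro integrable_continuous_real continuous_on_subset[OF \<phi>]) auto
      have "norm (u r) \<le> N * exp (- w * (r - \<tau>)) * ((1 + norm B) * c)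
           + integral {\<tau>..r} (\<lambda>s. N * exp (- w * (r - s)) * norm (F (u s)))"
        using False r c
        by (intro delay_duhamel_bound[OF S boundS T genT boundT N w \<tau> u Fu step]) (auto simp: uU)
      also have "integral {\<tau>..r} (\<lambda>s. N * exp (- w * (r - s)) * norm (F (u s)))
          \<le> integral {\<tau>..r} (\<lambda>s. exp (- w * (r - \<tau>)) * (N * q) * \<phi> s)"
      proof (rule integral_le)
        show "(\<lambda>s. N * exp (- w * (r - s)) * norm (F (u s))) integrable_on {\<tau>..r}"
          by (intro integrable_continuous_real continuous_intros continuous_on_subset[OF Fu]) simp
        show "(\<lambda>s. exp (- w * (r - \<tau>)) * (N * q) * \<phi> s) integrable_on {\<tau>..r}"
          by (intro integrable_on_mult_right \<phi>r)
        fix s assume s: "s \<in> {\<tau>..r}"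
        have "norm (F (u s)) \<le> q * norm (u s)" using q(2)[of s] s \<tau> by (simp add: uU)
        then have "N * exp (- w * (r - s)) * norm (F (u s)) \<le> N * exp (- w * (r - s)) * (q * norm (u s))"
          using N by (intro mult_left_mono) auto
        also have "\<dots> = exp (- w * (r - \<tau>)) * (N * q) * \<phi> s"
        proof -
          have "exp (- w * (r - s)) = exp (- w * (r - \<tau>)) * exp (w * (s - \<tau>))"
            by (simp add: exp_add[symmetric] algebra_simps)
          then show ?thesis by (simp only: \<phi>_def mult_ac)
        qed
        finally show "N * exp (- w * (r - s)) * norm (F (u s)) \<le> exp (- w * (r - \<tau>)) * (N * q) * \<phi> s" .
      qed
      finally have "norm (u r) \<le> exp (- w * (r - \<tau>)) * (N * (1 + norm B) * c + N * q * integral {\<tau>..r} \<phi>)"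
        by (simp add: algebra_simps)
      then have "exp (w * (r - \<tau>)) * norm (u r)
          \<le> exp (w * (r - \<tau>)) * (exp (- w * (r - \<tau>)) * (N * (1 + norm B) * c + N * q * integral {\<tau>..r} \<phi>))"
        by (rule mult_left_mono) simp
      also have "\<dots> = N * (1 + norm B) * c + N * q * integral {\<tau>..r} \<phi>"
        by (simp add: mult.assoc[symmetric] exp_add[symmetric])
      also have "\<dots> \<le> A + N * q * integral {\<tau>..r} \<phi>"
        using c0 by (simp add: A_def algebra_simps)
      finally show ?thesis by (simp add: \<phi>_def)
    qed
  qed (use t in simp)
  then have "exp (- w * (t - \<tau>)) * \<phi> t \<le> exp (- w * (t - \<tau>)) * (A * exp (N * q * (t - \<tau>)))"
    by (rule mult_left_mono) simp
  also have "exp (- w * (t - \<tau>)) * \<phi> t = norm (u t)"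
    by (simp add: \<phi>_def mult.assoc[symmetric] exp_add[symmetric])
  also have "exp (- w * (t - \<tau>)) * (A * exp (N * q * (t - \<tau>))) = A * exp (- (w - N * q) * (t - \<tau>))"
    by (simp add: mult.left_commute exp_add[symmetric] algebra_simps)
  finally show ?thesis using t \<tau> by (simp add: uU A_def)
qed

section \<open>Exponential decay\<close>

theorem theorem3p1:
  fixes A :: "('a::{real_inner, complete_space} \<times> 'a) set"
    and S :: "real \<Rightarrow> 'a \<Rightarrow>\<^sub>L 'a"
    and B :: "'a \<Rightarrow>\<^sub>L 'a"
    and T :: "real \<Rightarrow> real \<Rightarrow> ('a \<times> 'a L2) \<Rightarrow>\<^sub>L ('a \<times> 'a L2)"
    and F :: "'a \<Rightarrow> 'a"
    and chi :: "real \<Rightarrow> real"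
    and M \<omega> \<tau> :: real
    and Mt \<rho>0 C :: "real \<Rightarrow> real"
    and kbar :: ereal
  assumes semigroup: "C0_semigroup S" "generator S = A"
    and stable: "M > 0" "\<omega> > 0" "\<And>t. t \<ge> 0 \<Longrightarrow> norm (S t) \<le> M * exp (- \<omega> * t)"
    and delay: "\<tau> > 0"
    and delay_semigroup:
      "\<And>k. ereal \<bar>k\<bar> < k_zero M \<omega> B \<tau> \<Longrightarrow> C0_semigroup (T k)"
      "\<And>k. ereal \<bar>k\<bar> < k_zero M \<omega> B \<tau> \<Longrightarrow> generator (T k) = delay_operator A B \<tau> k"
    and delay_stable:
      "\<And>k. ereal \<bar>k\<bar> < k_zero M \<omega> B \<tau> \<Longrightarrow> Mt k > 0"
      "\<And>k t. ereal \<bar>k\<bar> < k_zero M \<omega> B \<tau> \<Longrightarrow> t > 0 \<Longrightarrow>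
         norm (T k t) \<le> Mt k * exp (- omega_prime M \<omega> B \<tau> k * t)"
    and locally_lipschitz:
      "\<And>c. c > 0 \<Longrightarrow> \<exists>L>0. \<forall>u v. norm u \<le> c \<and> norm v \<le> c \<longrightarrow>
         norm (F u - F v) \<le> L * norm (u - v)"
    and growth: "continuous_on {0..} chi" "strict_mono_on {0..} chi" "chi \<in> {0..} \<rightarrow> {0..}" "chi 0 = 0"
      "\<And>u. norm (F u) \<le> chi (norm u) * norm u"
    and kbar: "0 < kbar" "kbar \<le> k_zero M \<omega> B \<tau>"
    and well_posed:
      "\<And>k. ereal \<bar>k\<bar> < kbar \<Longrightarrow>
         \<rho>0 k > 0 \<and> C k > 0 \<and>
         ereal (C k) < extended_inverse chi (omega_prime M \<omega> B \<tau> k / Mt k) \<and>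
         (\<forall>U0 f. continuous_on {0..\<tau>} f \<and> small_data \<tau> k (\<rho>0 k) U0 f \<longrightarrow>
            (\<exists>U. mild_solution S F B \<tau> k U0 f U \<and>
                 (\<forall>V. mild_solution S F B \<tau> k U0 f V \<longrightarrow> (\<forall>t\<ge>0. V t = U t)) \<and>
                 (\<forall>t>0. norm (U t) \<le> C k)))"
  shows "\<exists>ktilde>0. \<forall>k. \<bar>k\<bar> < ktilde \<longrightarrow>
    (\<exists>Mstar>0. \<exists>wtilde>0. \<forall>U0 f U.
       continuous_on {0..\<tau>} f \<and> small_data \<tau> k (\<rho>0 k) U0 f \<and>
       mild_solution S F B \<tau> k U0 f U \<longrightarrow>
       (\<forall>t\<ge>\<tau>. norm (U t) \<le> Mstar * exp (- wtilde * t) *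
          (norm U0 + integral {0..\<tau>} (\<lambda>s. exp (\<omega> * s) * norm (f s)))))"
proof -
  have SM: "norm (S t) \<le> M" if "t \<ge> 0" for t
  proof -
    have "M * exp (- \<omega> * t) \<le> M * 1" using stable(1,2) that by (intro mult_left_mono) auto
    then show ?thesis using stable(3)[OF that] by simp
  qed
  have F: "continuous_on UNIV F" by (rule continuous_if_locally_lipschitz[OF locally_lipschitz])
  obtain ktilde where kt: "0 < ktilde" "ereal ktilde < kbar"
    using ereal_dense2[OF kbar(1)] by auto
  show ?thesis
  proof (rule exI[of _ ktilde], rule conjI[OF kt(1)], intro allI impI)
    fix k assume "\<bar>k\<bar> < ktilde"
    then have kb: "ereal \<bar>k\<bar> < kbar" using kt(2) by (meson ereal_less_eq(3) less_imp_le order.strict_trans1)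
    then have k0: "ereal \<bar>k\<bar> < k_zero M \<omega> B \<tau>" using kbar(2) by (rule order.strict_trans2)
    define w N q where "w = omega_prime M \<omega> B \<tau> k" and "N = Mt k" and "q = chi (C k)"
    have w: "w > 0" unfolding w_def by (rule omega_prime_pos[OF stable(1) delay stable(2) k0])
    have N: "N > 0" unfolding N_def by (rule delay_stable(1)[OF k0])
    have C: "C k > 0" "ereal (C k) < extended_inverse chi (w / N)"
      using well_posed[OF kb] by (auto simp: w_def N_def)
    have q: "q \<ge> 0" "N * q < w"
    proof -
      show "q \<ge> 0" using growth(3) C(1) by (auto simp: q_def)
      have "q < w / N"
        unfolding q_def using w N C by (intro less_extended_inverse[OF growth(1,2,4)]) auto
      then show "N * q < w" using N by (simp add: field_simps)
    qed
    \<comment> \<open>\<open>E\<close> controls the solution on \<open>{0..\<tau>}\<close> by the data; the last factor of \<open>Mstar\<close> moves the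
       origin of the decay from \<open>\<tau>\<close> back to 0.\<close>
    define E where "E = M * (1 + \<bar>k\<bar>) * exp (M * q * \<tau>)"
    define Mstar where "Mstar = (1 + N * (1 + norm B)) * E * exp ((w - N * q) * \<tau>)"
    have E: "E > 0" using stable(1) by (simp add: E_def add_pos_nonneg)
    have Mstar: "Mstar > 0" using E N by (simp add: Mstar_def add_pos_nonneg)
    show "\<exists>Mstar>0. \<exists>wtilde>0. \<forall>U0 f U.
       continuous_on {0..\<tau>} f \<and> small_data \<tau> k (\<rho>0 k) U0 f \<and>
       mild_solution S F B \<tau> k U0 f U \<longrightarrow>
       (\<forall>t\<ge>\<tau>. norm (U t) \<le> Mstar * exp (- wtilde * t) *
          (norm U0 + integral {0..\<tau>} (\<lambda>s. exp (\<omega> * s) * norm (f s))))"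
    proof (rule exI[of _ Mstar], rule conjI[OF Mstar], rule exI[of _ "w - N * q"], intro conjI allI impI)
      show "w - N * q > 0" using q by simp
      fix U0 f U t
      assume "continuous_on {0..\<tau>} f \<and> small_data \<tau> k (\<rho>0 k) U0 f \<and> mild_solution S F B \<tau> k U0 f U"
        and t: "t \<ge> \<tau>"
      then have f: "continuous_on {0..\<tau>} f" and small: "small_data \<tau> k (\<rho>0 k) U0 f"
        and mild: "mild_solution S F B \<tau> k U0 f U" by auto
      have "norm (U s) \<le> C k" if "s > 0" for s
        using well_posed[OF kb] f small mild that by (metis less_imp_le)
      \<comment> \<open>The a priori bound is assumed for positive times; continuity extends it to time 0.\<close>
      moreover have "continuous_on (closure {0<..}) U"
        using mild by (simp add: mild_solution_def)
      ultimately have UC: "norm (U s) \<le> C k" if "s \<ge> 0" for s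
        using continuous_on_closure_norm_le[of "{0<..}" U "C k" s] that by auto
      have FU: "norm (F (U s)) \<le> q * norm (U s)" if "s \<ge> 0" for s
      proof -
        have "chi (norm (U s)) \<le> q"
          unfolding q_def using UC[OF that] C(1)
          by (intro mono_onD[OF strict_mono_on_imp_mono_on[OF growth(2)]]) auto
        then have "chi (norm (U s)) * norm (U s) \<le> q * norm (U s)" by (rule mult_right_mono) simp
        with growth(5)[of "U s"] show ?thesis by (rule order.trans)
      qed
      define D where "D = norm U0 + integral {0..\<tau>} (\<lambda>s. exp (\<omega> * s) * norm (f s))"
      have early: "norm (U r) \<le> E * D" if r: "r \<in> {0..\<tau>}" for r
      proof -
        define I where "I = integral {0..\<tau>} (\<lambda>s. norm (f s))"
        have fi: "(\<lambda>s. norm (f s)) integrable_on {0..\<tau>}"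
          by (intro integrable_continuous_real continuous_intros f)
        have "I \<le> integral {0..\<tau>} (\<lambda>s. exp (\<omega> * s) * norm (f s))"
          unfolding I_def
        proof (rule integral_le[OF fi])
          show "(\<lambda>s. exp (\<omega> * s) * norm (f s)) integrable_on {0..\<tau>}"
            by (intro integrable_continuous_real continuous_intros f)
          show "norm (f s) \<le> exp (\<omega> * s) * norm (f s)" if "s \<in> {0..\<tau>}" for s
            using mult_right_mono[of 1 "exp (\<omega> * s)" "norm (f s)"] that stable(2) by simp
        qed
        moreover have I0: "I \<ge> 0" unfolding I_def by (intro integral_nonneg fi) simp
        ultimately have "norm U0 \<le> D" "I \<le> D"
          using norm_ge_zero[of U0] unfolding D_def by linarith+
        then have "norm U0 + \<bar>k\<bar> * I \<le> D + \<bar>k\<bar> * D"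
          by (intro add_mono mult_left_mono) auto
        then have le: "norm U0 + \<bar>k\<bar> * I \<le> (1 + \<bar>k\<bar>) * D" by (simp add: algebra_simps)
        have "norm (U r) \<le> M * (norm U0 + \<bar>k\<bar> * I) * exp (M * q * r)"
          unfolding I_def by (rule bound_up_to_delay[OF semigroup(1) SM F f mild q(1) FU r])
        also have "\<dots> \<le> M * ((1 + \<bar>k\<bar>) * D) * exp (M * q * \<tau>)"
        proof (intro mult_mono mult_left_mono le)
          have "0 \<le> norm U0 + \<bar>k\<bar> * I" using I0 by simp
          also note le
          finally show "0 \<le> M * ((1 + \<bar>k\<bar>) * D)" using stable(1) by simp
        qed (use stable(1) q(1) r I0 in \<open>auto intro: mult_left_mono\<close>)
        finally show ?thesis by (simp add: E_def mult_ac)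
      qed
      have "norm (U t) \<le> (1 + N * (1 + norm B)) * (E * D) * exp (- (w - N * q) * (t - \<tau>))"
        using semigroup(2) delay_semigroup[OF k0] delay_stable[OF k0] N w
        by (intro decay_beyond_delay[OF semigroup(1) SM _ _ _ _ _ delay F f mild q(1) FU early t, where T = "T k"])
           (auto simp: N_def w_def)
      also have "exp (- (w - N * q) * (t - \<tau>)) = exp (- (w - N * q) * t) * exp ((w - N * q) * \<tau>)"
        by (simp add: exp_add[symmetric] algebra_simps)
      finally show "norm (U t) \<le> Mstar * exp (- (w - N * q) * t) *
          (norm U0 + integral {0..\<tau>} (\<lambda>s. exp (\<omega> * s) * norm (f s)))"
        by (simp add: Mstar_def D_def mult_ac)
    qed
  qed
qed

end
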